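(* For any $\lambda_H$, $\lambda_E$, $p_E$, and $d$, if $\lambda_H<\lambda_E$ then $$\lim_{p_H\to0}p_H\,w_H^{\mathcal{C}(d)}<\lim_{p_H\to0}p_H\,w_H^{\mathcal{B}_H},$$ where $w_H^{\mathcal{C}(d)}$ and $w_H^{\mathcal{B}_H}$ are the steady-state average waiting times of $H$ agents under the policies ChainMatch(d) and BilateralMatch(H), respectively.
   Context: Model: agents of two types $H$ (hard-to-match) and $E$ (easy-to-match) arrive to a market according to independent Poisson processes with rates $\lambda_H,\lambda_E>0$. Each agent owns an item; an agent of type $T\in\{H,E\}$ finds the item of any other agent compatible with probability $p_T$, independently over all ordered pairs; there is a directed edge from $i$ to $j$ if $j$ finds $i$'s item compatible. Here $p_E\in(0,1]$ is a fixed constant and $p_H\in(0,1)$ is a parameter tending to $0$; $d\ge1$ is an integer constant independent of $p_H$. A waiting agent leaves only when matched, i.e. when she receives a compatible item. Policy BilateralMatch(H) ($\mathcal{B}_H$): upon arrival of a new agent, if a 2-cycle (edges in both directions) can be formed between it and a waiting agent, one such cycle is executed and both agents leave; if there are several such cycles, priority is given to cycles whose waiting agent is of type $H$, further ties being broken uniformly at random. Otherwise the new agent joins the market. The numbers $[H_t,E_t]\in\mathbb{N}^2$ of waiting agents form a positive recurrent continuous-time Markov chain with rates (convention $0^0=1$) $Q([h,e],[h+1,e])=\lambda_H(1-p_H^2)^h(1-p_Ep_H)^e$, $Q([h,e],[h-1,e])=\lambda_H(1-(1-p_H^2)^h)+\lambda_E(1-(1-p_Ep_H)^h)$, $Q([h,e],[h,e+1])=\lambda_E(1-p_Ep_H)^h(1-p_E^2)^e$,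 $Q([h,e],[h,e-1])=\lambda_H(1-p_H^2)^h(1-(1-p_Ep_H)^e)+\lambda_E(1-p_Ep_H)^h(1-(1-p_E^2)^e)$. Policy ChainMatch(d) ($\mathcal{C}(d)$): the market starts with $d$ altruistic agents, who give an item without requiring one; at all times there are exactly $d$ bridge agents (an altruistic agent who has not yet given, or an agent who has received an item but not yet given hers). When a new agent $i_1$ arrives: if no bridge agent has an edge to $i_1$, then $i_1$ joins the market and waits. Otherwise one of the bridge agents with an edge to $i_1$ is chosen uniformly at random and gives her item to $i_1$ (ceasing to be a bridge agent), starting a chain-segment. The chain-segment advances instantaneously by local search: if the current last agent has an edge to at least one waiting agent not already in the chain-segment, one of these is selected at random, with $H$ agents favored over $E$ agents, is matched by the last agent and becomes the new last agent; this is repeated until the last agent has no edge to a remaining waiting agent. All agents of the chain-segment leave the market, and the last one becomes a bridge agent. The numbers of waiting (non-bridge) $H$ and $E$ agents form a positive recurrent continuous-time Markov chain (each edge is examined at most once, so edges may be revealed only when examined). For each policy $\mathcal{P}$, $H^{\mathcal{P}}$ is the number of waiting $H$ agents in steady-state, and $w_H^{\mathcal{P}}=\mathbb{E}[H^{\mathcal{P}}]/\lambda_H$ (Little's law). *)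

theory Defs
  imports "HOL-Probability.Probability"
begin

text \<open>
  A state \<open>(h, e)\<close> gives the numbers of waiting H agents and waiting E agents.
  A chain is given by its rate function: \<open>Q x y\<close> is the rate of jumping from \<open>x\<close> to
  \<open>y \<noteq> x\<close>. Diagonal values of \<open>Q\<close> (arrivals that leave the state unchanged) are ignored.
\<close>

type_synonym state = "nat \<times> nat"

definition stationary :: "(state \<Rightarrow> state \<Rightarrow> real) \<Rightarrow> state pmf \<Rightarrow> bool" where
  "stationary Q \<pi> \<longleftrightarrow>
     (\<forall>y. ((\<lambda>x. pmf \<pi> x * Q x y) has_sum (pmf \<pi> y * (\<Sum>\<^sub>\<infinity>z\<in>- {y}. Q y z))) (- {y}))"

text \<open>
  The rates below are bounded, so the chains do not explode and their steady-state laws are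
  exactly the probability distributions satisfying global balance.
\<close>

definition steady_state :: "(state \<Rightarrow> state \<Rightarrow> real) \<Rightarrow> state pmf" where
  "steady_state Q = (THE \<pi>. stationary Q \<pi>)"

definition waiting_time_H :: "real \<Rightarrow> (state \<Rightarrow> state \<Rightarrow> real) \<Rightarrow> ennreal" where
  "waiting_time_H lH Q =
     (\<integral>\<^sup>+ s. of_nat (fst s) \<partial>measure_pmf (steady_state Q)) / ennreal lH"

fun bilateral_rate :: "real \<Rightarrow> real \<Rightarrow> real \<Rightarrow> real \<Rightarrow> state \<Rightarrow> state \<Rightarrow> real" where
  "bilateral_rate lH lE pE pH (h, e) (h', e') =
    (if h' = h + 1 \<and> e' = e then
       lH * (1 - pH\<^sup>2) ^ h * (1 - pE * pH) ^ e
     else if h = h' + 1 \<and> e' = e then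
       lH * (1 - (1 - pH\<^sup>2) ^ h) + lE * (1 - (1 - pE * pH) ^ h)
     else if h' = h \<and> e' = e + 1 then
       lE * (1 - pE * pH) ^ h * (1 - pE\<^sup>2) ^ e
     else if h' = h \<and> e = e' + 1 then
       lH * (1 - pH\<^sup>2) ^ h * (1 - (1 - pE * pH) ^ e)
         + lE * (1 - pE * pH) ^ h * (1 - (1 - pE\<^sup>2) ^ e)
     else 0)"

text \<open>Whether at least one of \<open>n\<close> potential edges, each present independently with
  probability \<open>p\<close>, is present.\<close>

definition some_edge :: "nat \<Rightarrow> real \<Rightarrow> bool pmf" where
  "some_edge n p = bernoulli_pmf (1 - (1 - p) ^ n)"

lemma some_edge_pos: "True \<in> set_pmf (some_edge n p) \<Longrightarrow> 0 < n"
  by (cases n) (auto simp: some_edge_def set_pmf_iff)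

text \<open>
  Law of the numbers of waiting agents left over when a chain-segment stops, if its current
  last agent faces \<open>h\<close> waiting H agents and \<open>e\<close> waiting E agents. The probability of an edge
  depends only on the type of its receiving agent, so neither the type of the last agent nor
  those of the bridge agents matter. Every edge examined is fresh: an agent examines the
  waiting agents once, when she is the last agent of a segment, and if she then becomes a
  bridge agent she only ever examines later arrivals.
\<close>

function chain_segment :: "real \<Rightarrow> real \<Rightarrow> nat \<Rightarrow> nat \<Rightarrow> state pmf" where
  "chain_segment pE pH h e =
     bind_pmf (some_edge h pH) (\<lambda>toH.
       if toH then chain_segment pE pH (h - 1) e
       else bind_pmf (some_edge e pE) (\<lambda>toE.
         if toE then chain_segment pE pH h (e - 1)
         else return_pmf (h, e)))"
  by pat_completeness auto
termination
  by (relation "Wellfounded.measure (\<lambda>(pE, pH, h, e). h + e)") (auto dest: some_edge_pos)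

declare chain_segment.simps [simp del]

text \<open>An arrival finds \<open>d\<close> bridge agents; if one of them has an edge to her she starts a
  chain-segment and does not enter the waiting pool, otherwise she joins it.\<close>

definition chain_arrival_H :: "nat \<Rightarrow> real \<Rightarrow> real \<Rightarrow> state \<Rightarrow> state pmf" where
  "chain_arrival_H d pE pH = (\<lambda>(h, e).
     bind_pmf (some_edge d pH) (\<lambda>b.
       if b then chain_segment pE pH h e else return_pmf (h + 1, e)))"

definition chain_arrival_E :: "nat \<Rightarrow> real \<Rightarrow> real \<Rightarrow> state \<Rightarrow> state pmf" where
  "chain_arrival_E d pE pH = (\<lambda>(h, e).
     bind_pmf (some_edge d pE) (\<lambda>b.
       if b then chain_segment pE pH h e else return_pmf (h, e + 1)))"

definition chain_rate ::
    "nat \<Rightarrow> real \<Rightarrow> real \<Rightarrow> real \<Rightarrow> real \<Rightarrow> state \<Rightarrow> state \<Rightarrow> real" where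
  "chain_rate d lH lE pE pH x y =
     lH * pmf (chain_arrival_H d pE pH x) y + lE * pmf (chain_arrival_E d pE pH x) y"

end

theory Submission
  imports Defs "HOL-Library.Diagonal_Subsequence" "HOL-Real_Asymp.Real_Asymp"
begin

text \<open>
  The bounded rates allow uniformization, so a steady state is an invariant law of a transition
  kernel. A Lyapunov function \<open>V\<close> whose generator image is at most \<open>b - g\<close> yields existence
  (averaging and tightness) as well as the bound \<open>b\<close> for the stationary mean of \<open>g\<close>. For both
  policies \<open>V\<close> is chosen such that \<open>b\<close> does not depend on \<open>p\<^sub>H\<close>, while \<open>p\<^sub>H g\<close> controls the
  distance of \<open>p\<^sub>H h\<close> from the zero of the fluid drift.

  Under BilateralMatch(H), with \<open>x = p\<^sub>H h\<close>, the fluid balance is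
  \<open>\<lambda>\<^sub>H = \<lambda>\<^sub>E (1 - exp (- p\<^sub>E x))\<close>. Under ChainMatch(d) every E agent is, in the long run, the last
  agent of a segment before exactly one run of H agents; such a run has mean length \<open>exp x - 1\<close>,
  so the balance is \<open>\<lambda>\<^sub>H = \<lambda>\<^sub>E (exp x - 1)\<close>. With \<open>r = \<lambda>\<^sub>H / \<lambda>\<^sub>E\<close> the claim becomes
  \<open>ln (1 + r) < - ln (1 - r) / p\<^sub>E\<close>.
\<close>

section \<open>Invariant laws of Markov kernels on a countable space\<close>

text \<open>\<open>steady_state\<close> is a definite description, so a bound on its mean
  presupposes existence and uniqueness; hence the drift condition always comes with finite sublevel
  sets and one state reachable from everywhere. Scale: h lives on scale 1/p, so V is taken of order
  1/p^2. Its curvature then costs only O(1), and the mean of p g is at most p b, which tends to 0.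
  Only the zero of p g matters, so no stationary law is ever computed. BilateralMatch(H): H arrivals
  also meet E agents, an effect of order p e on the drift of h. Times a deviation of order 1/p this
  is of order e, and only a quadratic term in e can pay for it. ChainMatch(d): the drift of h is not
  a function of h, since the length of a segment depends on e, a fast variable of order 1. The
  corrector gives equal value to stopping and to collecting one more E agent, so the edge
  probability \<open>pE\<close> cancels to leading order. The common factor 1 - \<gamma> z of
  \<open>w\<close> and \<open>G\<close> makes the remaining drift minus a perfect square.
  \<open>F\<close> is of order 1/p, whence the division of \<open>\<Phi>\<close> by p in
  \<open>V\<close>.\<close>

lemma pmf_le_imp_eq:
  assumes "\<And>y. pmf p y \<le> pmf q y"
  shows "p = q"
proof (rule pmf_eqI)
  fix y
  have "emeasure (measure_pmf p) (-{y}) \<le> emeasure (measure_pmf q) (-{y})"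
    unfolding nn_integral_pmf[symmetric] using assms by (intro nn_integral_mono) auto
  then have "measure (measure_pmf p) (-{y}) \<le> measure (measure_pmf q) (-{y})"
    by (simp add: measure_pmf.emeasure_eq_measure)
  moreover have "measure (measure_pmf r) (-{y}) = 1 - pmf r y" for r :: "'a pmf"
    using measure_pmf.prob_compl[of "{y}" r] by (simp add: Compl_eq_Diff_UNIV measure_pmf_single)
  ultimately show "pmf p y = pmf q y" using assms[of y] by simp
qed

text \<open>Pointwise limits of pmfs are controlled only on finite sets; monotone convergence along
  an enumeration carries such bounds to the whole space.\<close>

lemma nn_integral_count_space_le_finite_sums:
  fixes f :: "'a::countable \<Rightarrow> ennreal"
  assumes "\<And>A. finite A \<Longrightarrow> sum f A \<le> c"
  shows "(\<integral>\<^sup>+x. f x \<partial>count_space UNIV) \<le> c"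
proof -
  let ?A = "\<lambda>n. {x::'a. to_nat x < n}"
  have fin: "finite (?A n)" for n
    using finite_vimageI[of "{..<n}" "to_nat :: 'a \<Rightarrow> nat"] by (simp add: vimage_def)
  have "f x = (SUP n. f x * indicator (?A n) x)" for x
  proof (rule antisym)
    show "f x \<le> (SUP n. f x * indicator (?A n) x)"
      by (rule SUP_upper2[of "Suc (to_nat x)"]) auto
    show "(SUP n. f x * indicator (?A n) x) \<le> f x" by (intro SUP_least) (auto simp: indicator_def)
  qed
  then have "(\<integral>\<^sup>+x. f x \<partial>count_space UNIV)
      = (\<integral>\<^sup>+x. (SUP n. f x * indicator (?A n) x) \<partial>count_space UNIV)" by simp
  also have "\<dots> = (SUP n. \<integral>\<^sup>+x. f x * indicator (?A n) x \<partial>count_space UNIV)"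
    by (rule nn_integral_monotone_convergence_SUP)
      (auto simp: incseq_def le_fun_def indicator_def)
  also have "\<dots> \<le> c"
  proof (rule SUP_least)
    fix n
    have "(\<integral>\<^sup>+x. f x * indicator (?A n) x \<partial>count_space UNIV) = (\<integral>\<^sup>+x. f x \<partial>count_space (?A n))"
      by (simp add: nn_integral_count_space_indicator)
    also have "\<dots> = sum f (?A n)" by (rule nn_integral_count_space_finite[OF fin])
    finally show "(\<integral>\<^sup>+x. f x * indicator (?A n) x \<partial>count_space UNIV) \<le> c" using assms[OF fin] by simp
  qed
  finally show ?thesis .
qed

text \<open>V may have infinite mean under \<pi>, so its two integrals cannot simply be cancelled.
  The truncation min V N obeys the same inequality with f kept only on the set V \<le> N, because
  elsewhere min V N is already at its maximum. Then N tends to infinity.\<close>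

lemma kernel_drift_bound:
  fixes V f :: "'a \<Rightarrow> ennreal"
  assumes inv: "bind_pmf \<pi> K = \<pi>"
    and fin: "\<And>x. V x < \<top>"
    and drift: "\<And>x. (\<integral>\<^sup>+y. V y \<partial>K x) + f x \<le> V x + b"
  shows "(\<integral>\<^sup>+x. f x \<partial>\<pi>) \<le> b"
proof -
  define g where "g N x = f x * indicator {x. V x \<le> of_nat N} x" for N :: nat and x
  have step: "(\<integral>\<^sup>+y. min (V y) (of_nat N) \<partial>K x) + g N x \<le> min (V x) (of_nat N) + b" for N x
  proof (cases "V x \<le> of_nat N")
    case True
    have "(\<integral>\<^sup>+y. min (V y) (of_nat N) \<partial>K x) + g N x \<le> (\<integral>\<^sup>+y. V y \<partial>K x) + f x"
      using True by (intro add_mono nn_integral_mono) (auto simp: g_def)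
    with drift[of x] True show ?thesis by (simp add: min_def)
  next
    case False
    have "(\<integral>\<^sup>+y. min (V y) (of_nat N) \<partial>K x) \<le> (\<integral>\<^sup>+y. of_nat N \<partial>K x)"
      by (intro nn_integral_mono) auto
    with False show ?thesis by (auto simp: g_def min_def add_increasing2)
  qed
  have le: "(\<integral>\<^sup>+x. g N x \<partial>\<pi>) \<le> b" for N
  proof -
    define I where "I = (\<integral>\<^sup>+x. min (V x) (of_nat N) \<partial>\<pi>)"
    have "I \<le> (\<integral>\<^sup>+x. of_nat N \<partial>\<pi>)" unfolding I_def by (intro nn_integral_mono) auto
    then have "I < \<top>" by (simp add: le_less_trans of_nat_less_top)
    have "I = (\<integral>\<^sup>+x. \<integral>\<^sup>+y. min (V y) (of_nat N) \<partial>K x \<partial>\<pi>)"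
      unfolding I_def by (subst inv[symmetric], subst nn_integral_bind_pmf) simp
    then have "I + (\<integral>\<^sup>+x. g N x \<partial>\<pi>) = (\<integral>\<^sup>+x. (\<integral>\<^sup>+y. min (V y) (of_nat N) \<partial>K x) + g N x \<partial>\<pi>)"
      by (simp add: nn_integral_add)
    also have "\<dots> \<le> (\<integral>\<^sup>+x. min (V x) (of_nat N) + b \<partial>\<pi>)" by (intro nn_integral_mono step)
    also have "\<dots> = I + b" by (simp add: nn_integral_add I_def)
    finally show ?thesis using \<open>I < \<top>\<close> by (auto simp: ennreal_add_left_cancel_le)
  qed
  have "f x = (SUP N. g N x)" for x
  proof (rule antisym)
    obtain N where N: "V x \<le> of_nat N" using ennreal_Ex_less_of_nat[OF fin[of x]] less_imp_le by blast
    then show "f x \<le> (SUP N. g N x)" by (intro SUP_upper2[of N]) (auto simp: g_def)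
    show "(SUP N. g N x) \<le> f x" by (intro SUP_least) (auto simp: g_def indicator_def)
  qed
  then have "(\<integral>\<^sup>+x. f x \<partial>\<pi>) = (\<integral>\<^sup>+x. (SUP N. g N x) \<partial>\<pi>)" by simp
  also have "\<dots> = (SUP N. \<integral>\<^sup>+x. g N x \<partial>\<pi>)"
  proof (rule nn_integral_monotone_convergence_SUP)
    show "incseq g"
    proof (intro incseq_SucI le_funI)
      fix N x
      have "V x \<le> of_nat N \<Longrightarrow> V x \<le> of_nat (Suc N)"
        by (meson order_trans of_nat_mono le_SucI order_refl)
      then show "g N x \<le> g (Suc N) x" by (auto simp: g_def indicator_def)
    qed
  qed simp
  also have "\<dots> \<le> b" by (intro SUP_least le)
  finally show ?thesis .
qed

lemma invariant_pmf_pos: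
  assumes inv: "bind_pmf \<pi> K = \<pi>" and reach: "(\<lambda>x y. y \<in> set_pmf (K x))\<^sup>*\<^sup>* x y"
    and x: "x \<in> set_pmf \<pi>"
  shows "y \<in> set_pmf \<pi>"
  using reach
proof induction
  case (step y z)
  have "z \<in> set_pmf (bind_pmf \<pi> K)" using step by auto
  then show ?case by (simp add: inv)
qed (use x in simp)

text \<open>The law \<alpha> is the normalised positive part of \<pi> - \<rho>. Dropping the
  negative part in the difference of the two invariance equations makes \<alpha> sub-invariant;
  equal total mass turns this into invariance.\<close>

lemma positive_part_invariant:
  fixes \<pi> \<rho> :: "'a pmf"
  assumes inv: "bind_pmf \<pi> K = \<pi>" "bind_pmf \<rho> K = \<rho>" and ne: "\<pi> \<noteq> \<rho>"
  obtains \<alpha> where "bind_pmf \<alpha> K = \<alpha>" "\<And>x. x \<in> set_pmf \<alpha> \<Longrightarrow> pmf \<rho> x < pmf \<pi> x"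
proof -
  define a where "a x = max 0 (pmf \<pi> x - pmf \<rho> x)" for x
  define c where "c = (\<integral>\<^sup>+x. ennreal (a x) \<partial>count_space UNIV)"
  have "c \<le> (\<integral>\<^sup>+x. ennreal (pmf \<pi> x) \<partial>count_space UNIV)"
    unfolding c_def by (intro nn_integral_mono ennreal_leI) (simp add: a_def)
  then have "c \<le> 1" by (simp add: nn_integral_pmf)
  then have "c < \<top>" using le_less_trans ennreal_one_less_top by blast
  have "c \<noteq> 0"
  proof
    assume "c = 0"
    then have "\<And>x. a x \<le> 0" by (auto simp: c_def nn_integral_0_iff_AE AE_count_space ennreal_eq_0_iff)
    then have "\<And>x. pmf \<pi> x \<le> pmf \<rho> x" by (simp add: a_def) 
    then show False using ne pmf_le_imp_eq by blast
  qed
  define r where "r = enn2real c"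
  have r: "r > 0" "c = ennreal r"
    using \<open>c \<noteq> 0\<close> \<open>c < \<top>\<close> by (auto simp: r_def enn2real_positive_iff zero_less_iff_neq_zero)
  define \<alpha> where "\<alpha> = embed_pmf (\<lambda>x. a x / r)"
  have \<alpha>: "pmf \<alpha> x = a x / r" for x
    unfolding \<alpha>_def
  proof (rule pmf_embed_pmf)
    show "0 \<le> a x / r" for x using r by (simp add: a_def)
    have "(\<integral>\<^sup>+x. ennreal (a x / r) \<partial>count_space UNIV) = (\<integral>\<^sup>+x. ennreal (a x) / ennreal r \<partial>count_space UNIV)"
      using r by (intro nn_integral_cong divide_ennreal[symmetric]) (auto simp: a_def)
    also have "\<dots> = c / ennreal r" by (simp add: nn_integral_divide c_def)
    finally show "(\<integral>\<^sup>+x. ennreal (a x / r) \<partial>count_space UNIV) = 1" using r by (simp add: ennreal_divide_self)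
  qed
  have int: "integrable (measure_pmf p) (\<lambda>x. pmf (K x) y)" for p :: "'a pmf" and y
    by (rule measure_pmf.integrable_const_bound[where B=1]) (auto simp: pmf_le_1)
  have abs_sum: "integrable (count_space UNIV) (\<lambda>x. pmf p x * pmf (K x) y)" for p :: "'a pmf" and y
    using int[of p y] unfolding measure_pmf_eq_density[of p]
    by (subst (asm) integrable_density) auto
  have E: "pmf (bind_pmf p K) y = (\<integral>x. pmf p x * pmf (K x) y \<partial>count_space UNIV)" for p :: "'a pmf" and y
    unfolding pmf_bind unfolding measure_pmf_eq_density[of p]
    by (subst integral_density) auto
  have "pmf \<alpha> y \<le> pmf (bind_pmf \<alpha> K) y" for y
  proof (cases "a y = 0")
    case False
    then have "a y = pmf \<pi> y - pmf \<rho> y" by (simp add: a_def max_def split: if_splits)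
    also have "\<dots> = pmf (bind_pmf \<pi> K) y - pmf (bind_pmf \<rho> K) y" by (simp add: inv)
    also have "\<dots> = (\<integral>x. pmf \<pi> x * pmf (K x) y - pmf \<rho> x * pmf (K x) y \<partial>count_space UNIV)"
      unfolding E by (rule Bochner_Integration.integral_diff[symmetric]) (rule abs_sum)+
    also have "\<dots> \<le> (\<integral>x. r * (pmf \<alpha> x * pmf (K x) y) \<partial>count_space UNIV)"
    proof (rule integral_mono)
      show "integrable (count_space UNIV) (\<lambda>x. pmf \<pi> x * pmf (K x) y - pmf \<rho> x * pmf (K x) y)"
        by (intro Bochner_Integration.integrable_diff abs_sum)
      show "integrable (count_space UNIV) (\<lambda>x. r * (pmf \<alpha> x * pmf (K x) y))"
        by (intro integrable_mult_right abs_sum)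
      fix x
      have "(pmf \<pi> x - pmf \<rho> x) * pmf (K x) y \<le> a x * pmf (K x) y"
        by (intro mult_right_mono) (auto simp: a_def)
      then show "pmf \<pi> x * pmf (K x) y - pmf \<rho> x * pmf (K x) y \<le> r * (pmf \<alpha> x * pmf (K x) y)"
        using r by (simp add: \<alpha> algebra_simps)
    qed
    also have "\<dots> = r * pmf (bind_pmf \<alpha> K) y" unfolding E by simp
    finally show ?thesis using r by (simp add: \<alpha> field_simps)
  qed (simp add: \<alpha>)
  then have "\<alpha> = bind_pmf \<alpha> K" by (rule pmf_le_imp_eq)
  moreover have "pmf \<rho> x < pmf \<pi> x" if "x \<in> set_pmf \<alpha>" for x
    using that r by (auto simp: set_pmf_iff \<alpha> a_def max_def split: if_splits)
  ultimately show ?thesis using that by metis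
qed

text \<open>The positive and negative parts of \<pi> - \<rho> would give invariant laws with
  disjoint supports. The support of an invariant law is closed under transitions, so both would
  contain x0.\<close>

lemma invariant_pmf_unique:
  fixes \<pi> \<rho> :: "'a pmf"
  assumes inv: "bind_pmf \<pi> K = \<pi>" "bind_pmf \<rho> K = \<rho>"
    and reach: "\<And>x. (\<lambda>x y. y \<in> set_pmf (K x))\<^sup>*\<^sup>* x x0"
  shows "\<pi> = \<rho>"
proof (rule ccontr)
  assume ne: "\<pi> \<noteq> \<rho>"
  obtain \<alpha> where \<alpha>: "bind_pmf \<alpha> K = \<alpha>" "\<And>x. x \<in> set_pmf \<alpha> \<Longrightarrow> pmf \<rho> x < pmf \<pi> x"
    using positive_part_invariant[OF inv ne] by blast
  obtain \<beta> where \<beta>: "bind_pmf \<beta> K = \<beta>" "\<And>x. x \<in> set_pmf \<beta> \<Longrightarrow> pmf \<pi> x < pmf \<rho> x"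
    using positive_part_invariant[OF inv(2,1)] ne by metis
  have "x0 \<in> set_pmf \<alpha>" "x0 \<in> set_pmf \<beta>"
    using invariant_pmf_pos[OF \<alpha>(1) reach] invariant_pmf_pos[OF \<beta>(1) reach] set_pmf_not_empty
    by (metis ex_in_conv)+
  with \<alpha>(2) \<beta>(2) show False by force
qed

lemma pmf_seq_pointwise_convergent_subseq:
  fixes \<mu> :: "nat \<Rightarrow> 'a::countable pmf"
  obtains r where "strict_mono r" "\<And>y. convergent (\<lambda>n. pmf (\<mu> (r n)) y)"
proof -
  let ?P = "\<lambda>k s. convergent (\<lambda>n. pmf (\<mu> (s n)) (from_nat k))"
  interpret subseqs ?P
  proof
    fix k and s :: "nat \<Rightarrow> nat"
    have "bounded (range (\<lambda>n. pmf (\<mu> (s n)) (from_nat k)))"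
      by (rule boundedI[where B=1]) (auto simp: pmf_le_1)
    from bounded_imp_convergent_subsequence[OF this]
    show "\<exists>r'. strict_mono r' \<and> ?P k (s \<circ> r')" by (auto simp: o_def convergent_def)
  qed
  have conv: "?P k diagseq" for k
  proof -
    have "?P k (diagseq \<circ> (+) (Suc k))"
    proof (rule diagseq_holds)
      fix r s :: "nat \<Rightarrow> nat" and n
      assume r: "strict_mono r" and "?P n s"
      then show "?P n (s \<circ> r)"
        using convergent_subseq_convergent[of "\<lambda>n'. pmf (\<mu> (s n')) (from_nat n)" r] by (simp add: o_def)
    qed
    then have "convergent (\<lambda>n. pmf (\<mu> (diagseq (n + Suc k))) (from_nat k))"
      by (simp add: o_def add.commute)
    then show ?thesis by (subst (asm) convergent_ignore_initial_segment)
  qed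
  have "convergent (\<lambda>n. pmf (\<mu> (diagseq n)) y)" for y
    using conv[of "to_nat y"] by simp
  then show ?thesis by (rule that[OF subseq_diagseq])
qed

text \<open>Krylov-Bogoliubov: \<mu> n averages the laws at times 0 to n. Summing the drift
  inequality bounds the mean of f under \<mu> n uniformly in n, which is tightness because f has
  finite sublevel sets.\<close>

lemma invariant_pmf_exists:
  fixes K :: "'a::countable \<Rightarrow> 'a pmf" and V f :: "'a \<Rightarrow> ennreal"
  assumes fin: "\<And>x. V x < \<top>" and b: "b < \<top>"
    and drift: "\<And>x. (\<integral>\<^sup>+y. V y \<partial>K x) + f x \<le> V x + b"
    and level: "\<And>M::nat. finite {x. f x < of_nat M}"
  obtains \<pi> where "bind_pmf \<pi> K = \<pi>"
proof -
  fix x0 :: 'a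
  define law where "law n = ((\<lambda>p. bind_pmf p K) ^^ n) (return_pmf x0)" for n
  have law_Suc: "law (Suc n) = bind_pmf (law n) K" for n by (simp add: law_def)
  define \<mu> where "\<mu> n = bind_pmf (pmf_of_set {..n}) law" for n :: nat
  have pmf_\<mu>: "pmf (\<mu> n) y = (\<Sum>k\<le>n. pmf (law k) y) / real (Suc n)" for n y
    unfolding \<mu>_def by (subst pmf_bind_pmf_of_set) auto
  have sum_drift: "(\<integral>\<^sup>+x. V x \<partial>law n) + (\<Sum>k<n. \<integral>\<^sup>+x. f x \<partial>law k) \<le> V x0 + of_nat n * b" for n
  proof (induction n)
    case (Suc n)
    have "(\<integral>\<^sup>+x. V x \<partial>law (Suc n)) + (\<integral>\<^sup>+x. f x \<partial>law n)
        = (\<integral>\<^sup>+x. (\<integral>\<^sup>+y. V y \<partial>K x) + f x \<partial>law n)"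
      by (simp add: law_Suc nn_integral_add)
    also have "\<dots> \<le> (\<integral>\<^sup>+x. V x + b \<partial>law n)" by (intro nn_integral_mono drift)
    also have "\<dots> = (\<integral>\<^sup>+x. V x \<partial>law n) + b" by (simp add: nn_integral_add)
    finally have "(\<integral>\<^sup>+x. V x \<partial>law (Suc n)) + (\<integral>\<^sup>+x. f x \<partial>law n) + (\<Sum>k<n. \<integral>\<^sup>+x. f x \<partial>law k)
        \<le> (\<integral>\<^sup>+x. V x \<partial>law n) + b + (\<Sum>k<n. \<integral>\<^sup>+x. f x \<partial>law k)" by (rule add_right_mono)
    also have "\<dots> \<le> V x0 + of_nat n * b + b" using add_right_mono[OF Suc.IH, of b] by (simp add: ac_simps)
    finally show ?case by (simp add: algebra_simps)
  qed (simp add: law_def)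
  define M0 where "M0 = V x0 + b"
  have M0: "M0 < \<top>" using fin b by (simp add: M0_def)
  have mean: "(\<integral>\<^sup>+x. f x \<partial>\<mu> n) \<le> M0" for n
  proof -
    have "(\<Sum>k\<le>n. \<integral>\<^sup>+x. f x \<partial>law k) \<le> V x0 + of_nat (Suc n) * b"
      by (rule order_trans[OF _ sum_drift[of "Suc n"]]) (simp add: lessThan_Suc_atMost)
    also have "\<dots> \<le> of_nat (Suc n) * V x0 + of_nat (Suc n) * b"
      by (intro add_right_mono) (simp add: distrib_right)
    finally have *: "(\<Sum>k\<le>n. \<integral>\<^sup>+x. f x \<partial>law k) \<le> of_nat (Suc n) * M0" by (simp add: M0_def distrib_left)
    have "(\<integral>\<^sup>+x. f x \<partial>\<mu> n) = (\<Sum>k\<le>n. \<integral>\<^sup>+x. f x \<partial>law k) / of_nat (Suc n)"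
      unfolding \<mu>_def by (simp add: nn_integral_pmf_of_set)
    also have "\<dots> \<le> of_nat (Suc n) * M0 / of_nat (Suc n)" by (intro divide_right_mono_ennreal *)
    also have "\<dots> = M0" by (subst mult.commute, subst ennreal_mult_divide_eq) (auto simp del: of_nat_Suc)
    finally show ?thesis .
  qed
  define m where "m = enn2real M0"
  have m: "m \<ge> 0" "M0 = ennreal m" using M0 by (auto simp: m_def)
  \<comment> \<open>Markov's inequality for f. Finiteness of the sublevel set makes the bound a
    finite sum, which survives pointwise limits.\<close>
  have tight: "1 - m / real M \<le> (\<Sum>x | f x < of_nat M. pmf (\<mu> n) x)" if "M > 0" for M n
  proof -
    have *: "ennreal (real M) * emeasure (measure_pmf (\<mu> n)) {x. of_nat M \<le> f x} \<le> ennreal m"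
    proof -
      have "of_nat M * emeasure (measure_pmf (\<mu> n)) {x. of_nat M \<le> f x}
          = (\<integral>\<^sup>+x. of_nat M * indicator {x. of_nat M \<le> f x} x \<partial>\<mu> n)"
        by (simp add: nn_integral_cmult_indicator)
      also have "\<dots> \<le> (\<integral>\<^sup>+x. f x \<partial>\<mu> n)" by (intro nn_integral_mono) (auto simp: indicator_def)
      finally show ?thesis using mean[of n] m by (simp add: ennreal_of_nat_eq_real_of_nat)
    qed
    have "real M * measure (measure_pmf (\<mu> n)) {x. of_nat M \<le> f x} \<le> m"
      using * m by (simp add: measure_pmf.emeasure_eq_measure ennreal_mult[symmetric])
    then have "measure (measure_pmf (\<mu> n)) {x. of_nat M \<le> f x} \<le> m / real M"
      using that by (simp add: field_simps)
    moreover have "measure (measure_pmf (\<mu> n)) {x. of_nat M \<le> f x} = 1 - measure (measure_pmf (\<mu> n)) {x. f x < of_nat M}"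
      using measure_pmf.prob_compl[of "{x. f x < of_nat M}" "\<mu> n"]
      by (simp add: Compl_eq_Diff_UNIV[symmetric] Collect_neg_eq[symmetric] not_less)
    ultimately show ?thesis using level[of M] by (simp add: measure_measure_pmf_finite)
  qed
  obtain r where r: "strict_mono r" "\<And>y. convergent (\<lambda>n. pmf (\<mu> (r n)) y)"
    using pmf_seq_pointwise_convergent_subseq by blast
  define p where "p y = lim (\<lambda>n. pmf (\<mu> (r n)) y)" for y
  have lim: "(\<lambda>n. pmf (\<mu> (r n)) y) \<longlonglongrightarrow> p y" for y
    using r(2) by (simp add: p_def convergent_LIMSEQ_iff)
  have p0: "p y \<ge> 0" for y by (rule LIMSEQ_le_const[OF lim]) auto
  have sum_le: "sum p A \<le> 1" if "finite A" for A
  proof (rule LIMSEQ_le_const2)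
    show "(\<lambda>n. \<Sum>y\<in>A. pmf (\<mu> (r n)) y) \<longlonglongrightarrow> sum p A" by (intro tendsto_sum lim)
    show "\<exists>N. \<forall>n\<ge>N. (\<Sum>y\<in>A. pmf (\<mu> (r n)) y) \<le> 1"
      using that by (simp add: measure_measure_pmf_finite[symmetric])
  qed
  have sum_ge: "1 - m / real M \<le> (\<Sum>x | f x < of_nat M. p x)" if "M > 0" for M
  proof (rule LIMSEQ_le_const)
    show "(\<lambda>n. \<Sum>x | f x < of_nat M. pmf (\<mu> (r n)) x) \<longlonglongrightarrow> (\<Sum>x | f x < of_nat M. p x)"
      by (intro tendsto_sum lim)
  qed (use tight[OF that] in auto)
  define \<pi> where "\<pi> = embed_pmf p"
  have \<pi>: "pmf \<pi> y = p y" for y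
    unfolding \<pi>_def
  proof (rule pmf_embed_pmf)
    let ?S = "\<integral>\<^sup>+y. ennreal (p y) \<partial>count_space UNIV"
    have fin_le: "ennreal (sum p A) \<le> ?S" if "finite A" for A
    proof -
      have "ennreal (sum p A) = (\<Sum>y\<in>A. ennreal (p y))" by (simp add: p0 sum_ennreal)
      also have "\<dots> = (\<integral>\<^sup>+y. ennreal (p y) \<partial>count_space A)" using that by (simp add: nn_integral_count_space_finite)
      also have "\<dots> \<le> ?S" by (simp add: nn_integral_count_space_indicator) (intro nn_integral_mono, auto simp: indicator_def)
      finally show ?thesis .
    qed
    have "?S \<le> 1"
      by (rule nn_integral_count_space_le_finite_sums) (use sum_le p0 in \<open>simp add: sum_ennreal\<close>)
    moreover have "1 \<le> ?S"
    proof (rule LIMSEQ_le_const2)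
      have "(\<lambda>M. 1 - m / real (Suc M)) \<longlonglongrightarrow> 1 - 0"
        by (intro tendsto_diff tendsto_const LIMSEQ_Suc lim_const_over_n)
      then show "(\<lambda>M. ennreal (1 - m / real (Suc M))) \<longlonglongrightarrow> 1"
        using tendsto_ennrealI by fastforce
      show "\<exists>N. \<forall>M\<ge>N. ennreal (1 - m / real (Suc M)) \<le> ?S"
      proof (intro exI allI impI)
        fix M :: nat
        have "ennreal (1 - m / real (Suc M)) \<le> ennreal (\<Sum>x | f x < of_nat (Suc M). p x)"
          by (intro ennreal_leI sum_ge) simp
        also have "\<dots> \<le> ?S" by (intro fin_le level)
        finally show "ennreal (1 - m / real (Suc M)) \<le> ?S" .
      qed
    qed
    ultimately show "?S = 1" by (rule antisym)
  qed (rule p0)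
  \<comment> \<open>Applying K shifts the averaging window by one, so all but the two end terms
    cancel.\<close>
  have step: "pmf (bind_pmf (\<mu> n) K) y \<le> pmf (\<mu> n) y + 1 / real (Suc n)" for n y
  proof -
    have "bind_pmf (\<mu> n) K = bind_pmf (pmf_of_set {..n}) (\<lambda>k. law (Suc k))"
      by (simp add: \<mu>_def bind_assoc_pmf law_Suc)
    then have "pmf (bind_pmf (\<mu> n) K) y = (\<Sum>k\<le>n. pmf (law (Suc k)) y) / real (Suc n)"
      by (subst (asm) pmf_eq_iff) (simp add: pmf_bind_pmf_of_set)
    also have "(\<Sum>k\<le>n. pmf (law (Suc k)) y) \<le> (\<Sum>k\<le>n. pmf (law k) y) + 1"
    proof -
      have "(\<Sum>k\<le>n. pmf (law (Suc k)) y) + pmf (law 0) y = (\<Sum>k\<le>n. pmf (law k) y) + pmf (law (Suc n)) y"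
        by (induction n) simp_all
      then show ?thesis using pmf_le_1[of "law (Suc n)" y] pmf_nonneg[of "law 0" y] by linarith
    qed
    finally show ?thesis by (simp add: pmf_\<mu> add_divide_distrib divide_right_mono)
  qed
  \<comment> \<open>Only an inequality passes to the limit, via finite partial sums; total mass one
    then forces equality.\<close>
  have "pmf (bind_pmf \<pi> K) y \<le> pmf \<pi> y" for y
  proof -
    have part: "(\<Sum>x\<in>A. p x * pmf (K x) y) \<le> p y" if "finite A" for A
    proof (rule LIMSEQ_le)
      show "(\<lambda>n. \<Sum>x\<in>A. pmf (\<mu> (r n)) x * pmf (K x) y) \<longlonglongrightarrow> (\<Sum>x\<in>A. p x * pmf (K x) y)"
        by (intro tendsto_sum tendsto_mult lim tendsto_const)
      have "(\<lambda>n. 1 / real (Suc (r n))) \<longlonglongrightarrow> 0"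
        using LIMSEQ_subseq_LIMSEQ[OF LIMSEQ_inverse_real_of_nat r(1)] by (simp add: o_def inverse_eq_divide)
      then have "(\<lambda>n. pmf (\<mu> (r n)) y + 1 / real (Suc (r n))) \<longlonglongrightarrow> p y + 0"
        by (intro tendsto_add lim)
      then show "(\<lambda>n. pmf (\<mu> (r n)) y + 1 / real (Suc (r n))) \<longlonglongrightarrow> p y" by simp
      have "(\<Sum>x\<in>A. pmf (\<mu> n) x * pmf (K x) y) \<le> pmf (bind_pmf (\<mu> n) K) y" for n
      proof -
        have "(\<Sum>x\<in>A. pmf (\<mu> n) x * pmf (K x) y) = (\<integral>x. indicator A x * pmf (K x) y \<partial>\<mu> n)"
          using that by (subst integral_measure_pmf[of A]) (auto simp: indicator_def mult.commute)
        also have "\<dots> \<le> (\<integral>x. pmf (K x) y \<partial>\<mu> n)"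
        proof (rule integral_mono)
          show "integrable (measure_pmf (\<mu> n)) (\<lambda>x. indicator A x * pmf (K x) y)"
            by (rule measure_pmf.integrable_const_bound[where B=1]) (auto simp: pmf_le_1 indicator_def)
          show "integrable (measure_pmf (\<mu> n)) (\<lambda>x. pmf (K x) y)"
            by (rule measure_pmf.integrable_const_bound[where B=1]) (auto simp: pmf_le_1)
        qed (auto simp: indicator_def)
        finally show ?thesis by (simp add: pmf_bind)
      qed
      then show "\<exists>N. \<forall>n\<ge>N. (\<Sum>x\<in>A. pmf (\<mu> (r n)) x * pmf (K x) y) \<le> pmf (\<mu> (r n)) y + 1 / real (Suc (r n))"
        using step order_trans by blast
    qed
    have "ennreal (pmf (bind_pmf \<pi> K) y) = (\<integral>\<^sup>+x. ennreal (p x * pmf (K x) y) \<partial>count_space UNIV)"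
      by (simp add: ennreal_pmf_bind nn_integral_measure_pmf \<pi> ennreal_mult p0)
    also have "\<dots> \<le> ennreal (p y)"
      by (rule nn_integral_count_space_le_finite_sums)
        (use part p0 in \<open>simp add: sum_ennreal ennreal_leI\<close>)
    finally show ?thesis using p0 by (simp add: \<pi>)
  qed
  then have "bind_pmf \<pi> K = \<pi>" by (rule pmf_le_imp_eq)
  then show ?thesis by (rule that)
qed

section \<open>Uniformization and the limit of the mean\<close>

text \<open>\<open>N x\<close> may be any finite superset of the targets and may contain x itself,
  so x is removed wherever exit rates are summed.\<close>

locale finite_jump_rates =
  fixes Q :: "state \<Rightarrow> state \<Rightarrow> real" and N :: "state \<Rightarrow> state set" and \<Lambda> :: real
  assumes rate_nonneg: "\<And>x y. 0 \<le> Q x y"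
    and finite_targets: "\<And>x. finite (N x)"
    and rate_outside: "\<And>x y. y \<noteq> x \<Longrightarrow> y \<notin> N x \<Longrightarrow> Q x y = 0"
    and exit_rate_le: "\<And>x. (\<Sum>y\<in>N x - {x}. Q x y) \<le> \<Lambda>"
    and \<Lambda>_pos: "0 < \<Lambda>"
begin

definition exit_rate :: "state \<Rightarrow> real" where
  "exit_rate x = (\<Sum>y\<in>N x - {x}. Q x y)"

definition uniformized :: "state \<Rightarrow> state pmf" where
  "uniformized x = embed_pmf (\<lambda>y. if y = x then 1 - exit_rate x / \<Lambda> else Q x y / \<Lambda>)"

lemma pmf_uniformized:
  "pmf (uniformized x) y = (if y = x then 1 - exit_rate x / \<Lambda> else Q x y / \<Lambda>)"
  unfolding uniformized_def
proof (rule pmf_embed_pmf)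
  show nonneg: "0 \<le> (if y = x then 1 - exit_rate x / \<Lambda> else Q x y / \<Lambda>)" for y
    using rate_nonneg exit_rate_le \<Lambda>_pos by (simp add: exit_rate_def)
  have "(\<integral>\<^sup>+y. ennreal (if y = x then 1 - exit_rate x / \<Lambda> else Q x y / \<Lambda>) \<partial>count_space UNIV)
      = (\<Sum>y\<in>insert x (N x - {x}). ennreal (if y = x then 1 - exit_rate x / \<Lambda> else Q x y / \<Lambda>))"
    by (rule nn_integral_count_space') (use finite_targets rate_outside in auto)
  also have "\<dots> = ennreal (\<Sum>y\<in>insert x (N x - {x}). if y = x then 1 - exit_rate x / \<Lambda> else Q x y / \<Lambda>)"
    by (rule sum_ennreal) (rule nonneg)
  also have "(\<Sum>y\<in>insert x (N x - {x}). if y = x then 1 - exit_rate x / \<Lambda> else Q x y / \<Lambda>)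
      = 1 - exit_rate x / \<Lambda> + (\<Sum>y\<in>N x - {x}. Q x y / \<Lambda>)"
    using finite_targets by (subst sum.insert) (auto intro!: sum.cong)
  also have "\<dots> = 1" by (simp add: exit_rate_def sum_divide_distrib)
  finally show "(\<integral>\<^sup>+y. ennreal (if y = x then 1 - exit_rate x / \<Lambda> else Q x y / \<Lambda>) \<partial>count_space UNIV) = 1"
    by simp
qed

lemma set_pmf_uniformized: "set_pmf (uniformized x) \<subseteq> insert x (N x)"
proof
  fix y assume "y \<in> set_pmf (uniformized x)"
  then show "y \<in> insert x (N x)"
    using rate_outside[of y x] by (cases "y = x"; cases "y \<in> N x") (auto simp: set_pmf_iff pmf_uniformized)
qed

text \<open>Balance at y omits the diagonal. Removing the holding term of y from the one-step inflow
  and multiplying by \<Lambda> turns the invariance equation into the balance equation.\<close>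

lemma stationary_iff_invariant: "stationary Q \<pi> \<longleftrightarrow> bind_pmf \<pi> uniformized = \<pi>"
proof -
  let ?P = "bind_pmf \<pi> uniformized"
  have exit: "(\<Sum>\<^sub>\<infinity>z\<in>- {y}. Q y z) = exit_rate y" for y
  proof -
    have "(\<Sum>\<^sub>\<infinity>z\<in>- {y}. Q y z) = (\<Sum>\<^sub>\<infinity>z\<in>N y - {y}. Q y z)"
      by (rule infsum_cong_neutral) (auto intro!: rate_outside)
    then show ?thesis using finite_targets by (simp add: exit_rate_def)
  qed
  have total: "((\<lambda>x. pmf \<pi> x * pmf (uniformized x) y) has_sum pmf ?P y) UNIV" for y
  proof -
    have *: "Infinite_Set_Sum.abs_summable_on (\<lambda>x. pmf \<pi> x * pmf (uniformized x) y) UNIV"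
      by (rule abs_summable_on_comparison_test'[OF pmf_abs_summable[of \<pi>]])
        (auto simp: pmf_le_1 mult_left_le)
    then have "(\<lambda>x. pmf \<pi> x * pmf (uniformized x) y) summable_on UNIV"
      by (simp add: abs_summable_equivalent[symmetric] abs_summable_summable)
    moreover have "pmf ?P y = infsum (\<lambda>x. pmf \<pi> x * pmf (uniformized x) y) UNIV"
      by (simp add: pmf_bind pmf_expectation_eq_infsetsum infsetsum_infsum[OF *])
    ultimately show ?thesis by simp
  qed
  have off: "((\<lambda>x. pmf \<pi> x * Q x y) has_sum (\<Lambda> * (pmf ?P y - pmf \<pi> y) + pmf \<pi> y * exit_rate y)) (- {y})" for y
  proof -
    have "((\<lambda>x. pmf \<pi> x * pmf (uniformized x) y) has_sum (pmf ?P y - pmf \<pi> y * pmf (uniformized y) y)) (UNIV - {y})"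
      by (rule has_sum_Diff[OF total]) (auto intro: has_sum_finiteI)
    then have "((\<lambda>x. \<Lambda> * (pmf \<pi> x * pmf (uniformized x) y)) has_sum
        (\<Lambda> * (pmf ?P y - pmf \<pi> y * pmf (uniformized y) y))) (- {y})"
      by (intro has_sum_cmult_right) (simp add: Compl_eq_Diff_UNIV)
    also have "\<Lambda> * (pmf ?P y - pmf \<pi> y * pmf (uniformized y) y)
        = \<Lambda> * (pmf ?P y - pmf \<pi> y) + pmf \<pi> y * exit_rate y"
      using \<Lambda>_pos by (simp add: pmf_uniformized field_simps)
    also have "((\<lambda>x. \<Lambda> * (pmf \<pi> x * pmf (uniformized x) y)) has_sum \<dots>) (- {y}) \<longleftrightarrow>
        ((\<lambda>x. pmf \<pi> x * Q x y) has_sum \<dots>) (- {y})"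
      by (rule has_sum_cong) (use \<Lambda>_pos in \<open>auto simp: pmf_uniformized\<close>)
    finally show ?thesis .
  qed
  have "((\<lambda>x. pmf \<pi> x * Q x y) has_sum (pmf \<pi> y * exit_rate y)) (- {y}) \<longleftrightarrow> pmf ?P y = pmf \<pi> y" for y
    using has_sum_unique[OF off[of y], of "pmf \<pi> y * exit_rate y"] off[of y] \<Lambda>_pos by auto
  then show ?thesis by (simp add: stationary_def exit pmf_eq_iff)
qed

text \<open>Foster-Lyapunov criterion: the drift yields existence and the mean bound, while
  \<open>reach\<close> yields uniqueness, so that \<open>steady_state\<close> denotes. The constant
  c only shifts V and leaves no trace in the conclusion, so it may degenerate as the parameter of
  the chain tends to 0.\<close>

lemma steady_state_drift_bound:
  assumes V: "\<And>x. - c \<le> V x" and f: "\<And>x. 0 \<le> f x" and b: "0 \<le> b"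
    and drift: "\<And>x. (\<Sum>y\<in>N x. Q x y * (V y - V x)) \<le> b - f x"
    and level: "\<And>M. finite {x. f x \<le> M}"
    and reach: "\<And>x. (\<lambda>x y. 0 < Q x y)\<^sup>*\<^sup>* x z"
  shows "(\<integral>\<^sup>+x. ennreal (f x) \<partial>steady_state Q) \<le> ennreal b"
proof -
  define V' where "V' x = ennreal (V x + c)" for x
  define f' where "f' x = ennreal (f x / \<Lambda>)" for x
  define b' where "b' = ennreal (b / \<Lambda>)"
  have drift': "(\<integral>\<^sup>+y. V' y \<partial>uniformized x) + f' x \<le> V' x + b'" for x
  proof -
    have V0: "0 \<le> V y + c" for y using V[of y] by simp
    have "(\<integral>\<^sup>+y. V' y \<partial>uniformized x) = (\<Sum>y\<in>insert x (N x - {x}). V' y * pmf (uniformized x) y)"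
      by (rule nn_integral_measure_pmf_support) (use finite_targets set_pmf_uniformized[of x] in auto)
    also have "\<dots> = ennreal (\<Sum>y\<in>insert x (N x - {x}). (V y + c) * pmf (uniformized x) y)"
      by (simp add: V'_def V0 ennreal_mult'[symmetric] sum_ennreal del: sum.insert sum.insert_if)
    also have "(\<Sum>y\<in>insert x (N x - {x}). (V y + c) * pmf (uniformized x) y)
        = (V x + c) * (1 - exit_rate x / \<Lambda>) + (\<Sum>y\<in>N x - {x}. (V y + c) * (Q x y / \<Lambda>))"
      using finite_targets by (subst sum.insert) (auto simp: pmf_uniformized intro!: sum.cong)
    also have "\<dots> = V x + c + (\<Sum>y\<in>N x - {x}. Q x y * (V y - V x)) / \<Lambda>"
      using \<Lambda>_pos
      by (simp add: exit_rate_def sum_divide_distrib sum_distrib_left sum_subtractf right_diff_distrib sum.distrib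
          algebra_simps diff_divide_distrib add_divide_distrib)
    also have "(\<Sum>y\<in>N x - {x}. Q x y * (V y - V x)) = (\<Sum>y\<in>N x. Q x y * (V y - V x))"
      using finite_targets by (intro sum.mono_neutral_left) auto
    finally have *: "(\<integral>\<^sup>+y. V' y \<partial>uniformized x) = ennreal (V x + c + (\<Sum>y\<in>N x. Q x y * (V y - V x)) / \<Lambda>)" .
    have "(\<Sum>y\<in>N x. Q x y * (V y - V x)) / \<Lambda> \<le> (b - f x) / \<Lambda>"
      using drift \<Lambda>_pos by (intro divide_right_mono) auto
    then have "ennreal (V x + c + (\<Sum>y\<in>N x. Q x y * (V y - V x)) / \<Lambda>) + ennreal (f x / \<Lambda>)
       \<le> ennreal (V x + c + b / \<Lambda> - f x / \<Lambda>) + ennreal (f x / \<Lambda>)"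
      by (intro add_right_mono ennreal_leI) (simp add: diff_divide_distrib)
    \<comment> \<open>If V x + c + (b - f x) / \<Lambda> were negative, \<open>ennreal\<close> would
      clip it to 0 and the estimate would fail. That case is contradictory: the quantity bounds the
      expected next value of V + c, which is nonnegative.\<close>
    also have "\<dots> \<le> ennreal (V x + c) + ennreal (b / \<Lambda>)"
    proof (cases "f x \<le> \<Lambda> * (V x + c) + b")
      case True
      then have "f x / \<Lambda> \<le> (\<Lambda> * (V x + c) + b) / \<Lambda>" using \<Lambda>_pos by (intro divide_right_mono) auto
      then have "0 \<le> V x + c + b / \<Lambda> - f x / \<Lambda>" using \<Lambda>_pos by (simp add: add_divide_distrib)
      then show ?thesis using V0[of x] f[of x] b \<Lambda>_pos by (simp add: ennreal_plus[symmetric] del: ennreal_plus)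
    next
      case False
      have "0 \<le> V x + c + (\<Sum>y\<in>N x. Q x y * (V y - V x)) / \<Lambda>"
      proof -
        have "(\<Sum>y\<in>insert x (N x - {x}). (V y + c) * pmf (uniformized x) y) \<ge> 0"
          by (intro sum_nonneg mult_nonneg_nonneg V0) auto
        also have "(\<Sum>y\<in>insert x (N x - {x}). (V y + c) * pmf (uniformized x) y)
          = V x + c + (\<Sum>y\<in>N x - {x}. Q x y * (V y - V x)) / \<Lambda>"
          using finite_targets \<Lambda>_pos
          by (subst sum.insert) (auto simp: pmf_uniformized exit_rate_def sum_divide_distrib sum_distrib_left
            sum_subtractf right_diff_distrib sum.distrib
            algebra_simps diff_divide_distrib add_divide_distrib)
        also have "(\<Sum>y\<in>N x - {x}. Q x y * (V y - V x)) = (\<Sum>y\<in>N x. Q x y * (V y - V x))"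
          using finite_targets by (intro sum.mono_neutral_left) auto
        finally show ?thesis .
      qed
      with \<open>(\<Sum>y\<in>N x. Q x y * (V y - V x)) / \<Lambda> \<le> (b - f x) / \<Lambda>\<close> False \<Lambda>_pos
      show ?thesis by (simp add: field_simps)
    qed
    finally show ?thesis unfolding * unfolding V'_def f'_def b'_def .
  qed
  have fin: "V' x < \<top>" for x by (simp add: V'_def)
  have level': "finite {x. f' x < of_nat M}" for M
  proof (rule finite_subset[OF _ level[of "\<Lambda> * real M"]])
    show "{x. f' x < of_nat M} \<subseteq> {x. f x \<le> \<Lambda> * real M}"
      using \<Lambda>_pos f by (auto simp: f'_def ennreal_of_nat_eq_real_of_nat ennreal_less_iff field_simps)
  qed
  \<comment> \<open>Diagonal values of Q carry no meaning; steps from x to x are absorbed by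
    reflexivity of the closure.\<close>
  have "y \<in> set_pmf (uniformized x)" if "0 < Q x y" "y \<noteq> x" for x y
    using that \<Lambda>_pos by (simp add: set_pmf_iff pmf_uniformized)
  then have "(\<lambda>x y. 0 < Q x y) \<le> (\<lambda>x y. y \<in> set_pmf (uniformized x))\<^sup>*\<^sup>*"
    by (auto simp: le_fun_def) (metis r_into_rtranclp rtranclp.rtrancl_refl)
  then have "(\<lambda>x y. 0 < Q x y)\<^sup>*\<^sup>* \<le> (\<lambda>x y. y \<in> set_pmf (uniformized x))\<^sup>*\<^sup>*"
    by (subst rtranclp_idemp[of "\<lambda>x y. y \<in> set_pmf (uniformized x)", symmetric]) (rule rtranclp_mono)
  then have reach': "(\<lambda>x y. y \<in> set_pmf (uniformized x))\<^sup>*\<^sup>* x z" for x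
    using reach[of x] by (rule predicate2D)
  obtain \<pi> where \<pi>: "bind_pmf \<pi> uniformized = \<pi>"
  proof (rule invariant_pmf_exists[of V' b' uniformized f'])
    show "b' < \<top>" by (simp add: b'_def)
  qed (use fin drift' level' in blast)+
  have "steady_state Q = \<pi>"
    unfolding steady_state_def stationary_iff_invariant
  proof (rule the_equality)
    show "bind_pmf \<pi> uniformized = \<pi>" by (fact \<pi>)
    fix \<rho> assume "bind_pmf \<rho> uniformized = \<rho>"
    then show "\<rho> = \<pi>" using \<pi> reach' by (rule invariant_pmf_unique)
  qed
  moreover have "(\<integral>\<^sup>+x. f' x \<partial>\<pi>) \<le> b'"
    by (rule kernel_drift_bound[where V=V' and K=uniformized, OF \<pi> fin drift'])
  moreover have "(\<integral>\<^sup>+x. ennreal (f x) \<partial>\<pi>) = ennreal \<Lambda> * (\<integral>\<^sup>+x. f' x \<partial>\<pi>)"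
  proof -
    have "ennreal (f x) = ennreal \<Lambda> * f' x" for x
      using \<Lambda>_pos f[of x] by (simp add: f'_def ennreal_mult[symmetric])
    then show ?thesis by (simp add: nn_integral_cmult)
  qed
  moreover have "ennreal \<Lambda> * b' = ennreal b"
    using \<Lambda>_pos b by (simp add: b'_def ennreal_mult[symmetric])
  ultimately show ?thesis by (metis mult_left_mono zero_le)
qed

end

section \<open>From stationary mean bounds to the limit of the scaled waiting time\<close>

lemma of_nat_mult_power_le:
  fixes x :: real
  assumes "0 \<le> x" "x < 1"
  shows "real n * x ^ n \<le> 1 / (1 - x)"
proof -
  have "real n * x ^ n = (\<Sum>k<n. x ^ n)" by simp
  also have "\<dots> \<le> (\<Sum>k<n. x ^ k)" using assms by (intro sum_mono power_decreasing) auto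
  also have "\<dots> = (1 - x ^ n) / (1 - x)" using assms by (subst sum_gp_strict) auto
  also have "\<dots> \<le> 1 / (1 - x)" using assms by (intro divide_right_mono) auto
  finally show ?thesis .
qed

text \<open>Averaging \<open>close\<close> over the steady state gives an error of at most \<delta>
  + K C p. Since p tends to 0 with \<delta> fixed, K may depend on \<delta>. In both uses
  \<open>h p\<close> is the exact zero of the leading drift for that p.\<close>

lemma waiting_time_tendsto:
  fixes Q :: "real \<Rightarrow> state \<Rightarrow> state \<Rightarrow> real" and g :: "real \<Rightarrow> state \<Rightarrow> real" and h :: "real \<Rightarrow> real"
  assumes lH: "0 < lH" and C: "0 \<le> C"
    and bound: "\<forall>\<^sub>F p in at_right 0. (\<forall>x. 0 \<le> g p x) \<and> (\<integral>\<^sup>+x. ennreal (g p x) \<partial>steady_state (Q p)) \<le> ennreal C"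
    and close: "\<And>\<delta>. 0 < \<delta> \<Longrightarrow>
      \<exists>K\<ge>0. \<forall>\<^sub>F p in at_right 0. \<forall>x. \<bar>p * real (fst x) - p * h p\<bar> \<le> \<delta> + K * p * g p x"
    and h: "\<forall>\<^sub>F p in at_right 0. 0 \<le> h p" and lim: "((\<lambda>p. p * h p) \<longlongrightarrow> y) (at_right 0)"
  shows "((\<lambda>p. ennreal p * waiting_time_H lH (Q p)) \<longlongrightarrow> ennreal (y / lH)) (at_right 0)"
proof -
  define J where "J p = (\<integral>\<^sup>+x. ennreal (p * real (fst x)) \<partial>steady_state (Q p))" for p
  define j where "j p = enn2real (J p)" for p
  have pos: "\<forall>\<^sub>F p in at_right (0::real). 0 < p" by (simp add: eventually_at_right_less)
  have main: "\<exists>K\<ge>0. \<forall>\<^sub>F p in at_right 0. J p < \<top> \<and> \<bar>j p - p * h p\<bar> \<le> \<delta> + K * p" if \<delta>: "0 < \<delta>" for \<delta>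
  proof -
    obtain K where K: "K \<ge> 0" and
      ev: "\<forall>\<^sub>F p in at_right 0. \<forall>x. \<bar>p * real (fst x) - p * h p\<bar> \<le> \<delta> + K * p * g p x"
      using close[OF \<delta>] by blast
    have "\<forall>\<^sub>F p in at_right 0. J p < \<top> \<and> \<bar>j p - p * h p\<bar> \<le> \<delta> + K * C * p"
      using ev bound h pos
    proof eventually_elim
      case (elim p)
      let ?\<pi> = "measure_pmf (steady_state (Q p))"
      have g0: "0 \<le> g p x" for x using elim by blast
      have "(\<integral>\<^sup>+x. ennreal (\<delta> + K * p * g p x) \<partial>?\<pi>)
          = ennreal \<delta> + ennreal (K * p) * (\<integral>\<^sup>+x. ennreal (g p x) \<partial>?\<pi>)"
      proof -
        have "ennreal (\<delta> + K * p * g p x) = ennreal \<delta> + ennreal (K * p) * ennreal (g p x)" for x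
        proof -
          have Kp: "0 \<le> K * p" using K elim by simp
          then have "0 \<le> K * p * g p x" by (rule mult_nonneg_nonneg[OF _ g0])
          then show ?thesis using \<delta> by (simp add: ennreal_plus ennreal_mult[OF Kp g0] del: ennreal_mult)
        qed
        then show ?thesis by (simp add: nn_integral_add nn_integral_cmult)
      qed
      also have "\<dots> \<le> ennreal \<delta> + ennreal (K * p) * ennreal C"
        using elim by (intro add_left_mono mult_left_mono) auto
      also have "\<dots> = ennreal (\<delta> + K * C * p)"
        using K \<delta> C elim by (simp add: ennreal_mult[symmetric] ennreal_plus[symmetric] mult.commute mult.left_commute del: ennreal_plus)
      finally have err: "(\<integral>\<^sup>+x. ennreal (\<delta> + K * p * g p x) \<partial>?\<pi>) \<le> ennreal (\<delta> + K * C * p)" .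
      have e0: "0 \<le> \<delta> + K * p * g p x" for x using K \<delta> elim
        by (auto intro!: add_nonneg_nonneg mult_nonneg_nonneg g0)
      have "J p \<le> (\<integral>\<^sup>+x. ennreal (p * h p) + ennreal (\<delta> + K * p * g p x) \<partial>?\<pi>)"
        unfolding J_def
      proof (intro nn_integral_mono)
        fix x
        have "p * real (fst x) \<le> p * h p + (\<delta> + K * p * g p x)" using elim(1)[rule_format, of x] by linarith
        then have "ennreal (p * real (fst x)) \<le> ennreal (p * h p + (\<delta> + K * p * g p x))" by (rule ennreal_leI)
        then show "ennreal (p * real (fst x)) \<le> ennreal (p * h p) + ennreal (\<delta> + K * p * g p x)"
          using elim e0[of x] by (subst (asm) ennreal_plus) auto
      qed
      also have "\<dots> \<le> ennreal (p * h p) + ennreal (\<delta> + K * C * p)"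
        using err by (simp add: nn_integral_add add_left_mono)
      also have "\<dots> = ennreal (p * h p + (\<delta> + K * C * p))"
        using elim K C \<delta> by (intro ennreal_plus[symmetric]) auto
      finally have up: "J p \<le> ennreal (p * h p + (\<delta> + K * C * p))" .
      then have fin: "J p < \<top>" using le_less_trans ennreal_less_top by blast
      then have Jj: "J p = ennreal (j p)" by (simp add: j_def)
      have j0: "0 \<le> j p" by (simp add: j_def)
      have "j p \<le> p * h p + (\<delta> + K * C * p)"
        using up unfolding Jj using elim K C \<delta> by (subst (asm) ennreal_le_iff) auto
      \<comment> \<open>For the lower bound the error is added on the right, since subtraction in
        \<open>ennreal\<close> truncates.\<close>
      moreover have "ennreal (p * h p) \<le> (\<integral>\<^sup>+x. ennreal (p * real (fst x)) + ennreal (\<delta> + K * p * g p x) \<partial>?\<pi>)"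
      proof -
        have "ennreal (p * h p) = (\<integral>\<^sup>+x. ennreal (p * h p) \<partial>?\<pi>)" by simp
        also have "\<dots> \<le> (\<integral>\<^sup>+x. ennreal (p * real (fst x)) + ennreal (\<delta> + K * p * g p x) \<partial>?\<pi>)"
        proof (intro nn_integral_mono)
          fix x
          have "p * h p \<le> p * real (fst x) + (\<delta> + K * p * g p x)" using elim(1)[rule_format, of x] by linarith
          then have "ennreal (p * h p) \<le> ennreal (p * real (fst x) + (\<delta> + K * p * g p x))" by (rule ennreal_leI)
          then show "ennreal (p * h p) \<le> ennreal (p * real (fst x)) + ennreal (\<delta> + K * p * g p x)"
            using elim e0[of x] by (subst (asm) ennreal_plus) auto
        qed
        finally show ?thesis .
      qed
      then have "ennreal (p * h p) \<le> J p + ennreal (\<delta> + K * C * p)"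
        using err by (simp add: nn_integral_add J_def) (meson add_left_mono order_trans)
      then have "ennreal (p * h p) \<le> ennreal (j p + (\<delta> + K * C * p))"
        unfolding Jj using j0 elim K C \<delta> by (subst ennreal_plus) auto
      then have "p * h p \<le> j p + (\<delta> + K * C * p)"
        using j0 elim K C \<delta> by (subst (asm) ennreal_le_iff) auto
      ultimately show ?case using fin by (simp add: abs_le_iff)
    qed
    then show ?thesis using K C by (intro exI[of _ "K * C"]) auto
  qed
  have diff: "((\<lambda>p. j p - p * h p) \<longlongrightarrow> 0) (at_right 0)"
  proof (rule tendstoI)
    fix e :: real assume e: "0 < e"
    obtain K where K: "K \<ge> 0" and ev: "\<forall>\<^sub>F p in at_right 0. J p < \<top> \<and> \<bar>j p - p * h p\<bar> \<le> e / 2 + K * p"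
      using main[of "e / 2"] e by auto
    have "((\<lambda>p. K * p) \<longlongrightarrow> K * 0) (at_right 0)" by (intro tendsto_intros)
    then have "\<forall>\<^sub>F p in at_right 0. K * p < e / 2" using e by (intro order_tendstoD(2)) auto
    with ev show "\<forall>\<^sub>F p in at_right 0. dist (j p - p * h p) 0 < e"
      by eventually_elim (auto simp: dist_real_def)
  qed
  have "(j \<longlongrightarrow> y) (at_right 0)"
    using tendsto_add[OF diff lim] by simp
  then have "((\<lambda>p. ennreal (j p / lH)) \<longlongrightarrow> ennreal (y / lH)) (at_right 0)"
    using lH by (intro tendsto_ennrealI tendsto_intros) auto
  moreover obtain K where "\<forall>\<^sub>F p in at_right 0. J p < \<top> \<and> \<bar>j p - p * h p\<bar> \<le> 1 + K * p"
    using main[of 1] by auto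
  then have "\<forall>\<^sub>F p in at_right 0. ennreal (j p / lH) = ennreal p * waiting_time_H lH (Q p)"
    using pos
  proof eventually_elim
    case (elim p)
    have "J p = (\<integral>\<^sup>+x. ennreal p * of_nat (fst x) \<partial>steady_state (Q p))"
      using elim unfolding J_def by (simp add: ennreal_mult ennreal_of_nat_eq_real_of_nat)
    also have "\<dots> = ennreal p * (\<integral>\<^sup>+x. of_nat (fst x) \<partial>steady_state (Q p))"
      by (simp add: nn_integral_cmult)
    finally have "ennreal p * waiting_time_H lH (Q p) = J p / ennreal lH"
      by (simp add: waiting_time_H_def ennreal_times_divide)
    also have "J p = ennreal (j p)" using elim by (simp add: j_def)
    finally show ?case using lH by (simp add: divide_ennreal j_def)
  qed
  ultimately show ?thesis by (rule Lim_transform_eventually)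
qed

section \<open>BilateralMatch(H)\<close>

text \<open>v (1 - exp (- v)) is quadratic at 0, so it dominates \<bar>v\<bar> only up to an
  additive \<delta>. Outside [- \<delta>, \<delta>] the factor 1 - exp (- v) has modulus at least 1
  - exp (- \<delta>), the negative side being the steeper one.\<close>

lemma abs_le_mult_one_minus_exp:
  fixes v \<delta> :: real
  assumes "0 < \<delta>"
  shows "\<bar>v\<bar> \<le> \<delta> + v * (1 - exp (- v)) / (1 - exp (- \<delta>))"
proof -
  have d: "0 < 1 - exp (- \<delta>)" using assms by simp
  have nonneg: "0 \<le> v * (1 - exp (- v))"
    by (cases "0 \<le> v") (auto intro: mult_nonneg_nonneg mult_nonpos_nonpos)
  show ?thesis
  proof (cases "\<bar>v\<bar> \<le> \<delta>")
    case True
    then show ?thesis using divide_nonneg_pos[OF nonneg d] by simp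
  next
    case False
    have "\<bar>v\<bar> * (1 - exp (- \<delta>)) \<le> v * (1 - exp (- v))"
    proof (cases "0 \<le> v")
      case True
      then show ?thesis using False by (simp add: mult_left_mono)
    next
      case neg: False
      have "exp \<delta> + exp (- \<delta>) \<ge> 2"
        using exp_ge_add_one_self[of \<delta>] exp_ge_add_one_self[of "- \<delta>"] by linarith
      moreover have "exp \<delta> \<le> exp (- v)" using neg False by simp
      ultimately have "1 - exp (- \<delta>) \<le> exp (- v) - 1" by linarith
      then have "(- v) * (1 - exp (- \<delta>)) \<le> (- v) * (exp (- v) - 1)"
        using neg by (intro mult_left_mono) auto
      then show ?thesis using neg by (simp add: algebra_simps)
    qed
    then have "\<bar>v\<bar> \<le> v * (1 - exp (- v)) / (1 - exp (- \<delta>))" using d by (simp add: pos_le_divide_eq)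
    then show ?thesis using assms by linarith
  qed
qed

locale bilateral_match =
  fixes lH lE c p :: real
  assumes lH: "0 < lH" and lE: "lH < lE" and c: "0 < c" "c \<le> 1" and p: "0 < p" "p < 1"
begin

definition neighbours :: "state \<Rightarrow> state set" where
  "neighbours = (\<lambda>(h, e). {(h + 1, e), (h, e + 1)}
     \<union> (if h = 0 then {} else {(h - 1, e)}) \<union> (if e = 0 then {} else {(h, e - 1)}))"

definition upH :: "nat \<Rightarrow> nat \<Rightarrow> real" where
  "upH h e = lH * (1 - p\<^sup>2) ^ h * (1 - c * p) ^ e"

definition downH :: "nat \<Rightarrow> real" where
  "downH h = lH * (1 - (1 - p\<^sup>2) ^ h) + lE * (1 - (1 - c * p) ^ h)"

definition upE :: "nat \<Rightarrow> nat \<Rightarrow> real" where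
  "upE h e = lE * (1 - c * p) ^ h * (1 - c\<^sup>2) ^ e"

definition downE :: "nat \<Rightarrow> nat \<Rightarrow> real" where
  "downE h e = lH * (1 - p\<^sup>2) ^ h * (1 - (1 - c * p) ^ e)
     + lE * (1 - c * p) ^ h * (1 - (1 - c\<^sup>2) ^ e)"

lemma probs: "0 \<le> 1 - p\<^sup>2" "1 - p\<^sup>2 \<le> 1" "0 < 1 - c * p" "1 - c * p < 1" "0 \<le> 1 - c\<^sup>2" "1 - c\<^sup>2 < 1"
proof -
  have "c * p \<le> 1 * p" using c p by (intro mult_right_mono) auto
  then show "0 < 1 - c * p" using p by linarith
qed (use c p in \<open>auto simp: power_le_one\<close>)

lemma powers: "0 \<le> (1 - p\<^sup>2) ^ n" "(1 - p\<^sup>2) ^ n \<le> 1" "0 < (1 - c * p) ^ n" "(1 - c * p) ^ n \<le> 1"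
  "0 \<le> (1 - c\<^sup>2) ^ n" "(1 - c\<^sup>2) ^ n \<le> 1"
  using probs by (auto intro: power_le_one)

text \<open>At h = 0 or e = 0 the truncated predecessor is the state itself, but then
  \<open>downH 0\<close> or \<open>downE h 0\<close> is 0, so the four-term form still
  holds.\<close>

lemma bilateral_sum:
  "(\<Sum>y\<in>neighbours (h, e). bilateral_rate lH lE c p (h, e) y * F y)
     = upH h e * F (h + 1, e) + downH h * F (h - 1, e) + upE h e * F (h, e + 1) + downE h e * F (h, e - 1)"
  by (cases h; cases e) (auto simp: neighbours_def upH_def downH_def upE_def downE_def)

lemma rates_nonneg: "0 \<le> upH h e" "0 \<le> downH h" "0 \<le> upE h e" "0 \<le> downE h e"
  using powers lH lE by (auto simp: upH_def downH_def upE_def downE_def less_imp_le)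

lemma rates_le: "upH h e \<le> lH" "downH h \<le> lH + lE" "upE h e \<le> lE" "downE h e \<le> lH + lE"
proof -
  have le: "a * x * y \<le> a" if "0 \<le> a" "0 \<le> x" "x \<le> 1" "0 \<le> y" "y \<le> 1" for a x y :: real
    using that by (metis mult.assoc mult_le_one mult_left_le)
  have le2: "a * (1 - x) \<le> a" if "0 \<le> a" "0 \<le> x" for a x :: real
    using that by (simp add: right_diff_distrib)
  show "upH h e \<le> lH" "upE h e \<le> lE"
    unfolding upH_def upE_def using powers lH lE by (intro le; simp add: less_imp_le)+
  show "downH h \<le> lH + lE"
    unfolding downH_def using powers lH lE by (intro add_mono le2) (auto simp: less_imp_le)
  show "downE h e \<le> lH + lE"
    unfolding downE_def using powers lH lE by (intro add_mono le) (auto simp: less_imp_le)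
qed

sublocale finite_jump_rates "bilateral_rate lH lE c p" neighbours "3 * lH + 3 * lE"
proof
  show "0 \<le> bilateral_rate lH lE c p x y" for x y
    using rates_nonneg[unfolded upH_def downH_def upE_def downE_def] by (cases x; cases y) (simp del: power_Suc)
  show "finite (neighbours x)" for x by (cases x) (simp add: neighbours_def)
  show "bilateral_rate lH lE c p x y = 0" if "y \<noteq> x" "y \<notin> neighbours x" for x y
    using that by (cases x; cases y) (auto simp: neighbours_def split: if_splits)
  show "(\<Sum>y\<in>neighbours x - {x}. bilateral_rate lH lE c p x y) \<le> 3 * lH + 3 * lE" for x
  proof -
    obtain h e where x: "x = (h, e)" by (cases x)
    have "neighbours x - {x} = neighbours x" by (auto simp: x neighbours_def split: if_splits)
    then have "(\<Sum>y\<in>neighbours x - {x}. bilateral_rate lH lE c p x y)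
        = upH h e + downH h + upE h e + downE h e"
      using bilateral_sum[of h e "\<lambda>_. 1"] by (simp add: x)
    then show ?thesis using rates_le(1,3,4)[of h e] rates_le(2)[of h] lH lE by linarith
  qed
  show "0 < 3 * lH + 3 * lE" using lH lE by simp
qed

lemma bilateral_reach: "(\<lambda>x y. 0 < bilateral_rate lH lE c p x y)\<^sup>*\<^sup>* x (0, 0)"
proof -
  have pos: "0 < 1 - (1 - c * p) ^ Suc n" for n
    using probs(3,4) power_Suc_less_one[of "1 - c * p" n] by simp
  have e: "(\<lambda>x y. 0 < bilateral_rate lH lE c p x y)\<^sup>*\<^sup>* (0, e) (0, 0)" for e
  proof (induction e)
    case (Suc e)
    have "0 < bilateral_rate lH lE c p (0, Suc e) (0, e)"
      using lH lE pos[of e] powers(5,6)[of "Suc e"]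
      by (simp del: power_Suc) (intro add_pos_nonneg mult_pos_pos mult_nonneg_nonneg; simp del: power_Suc)
    then show ?case using Suc by (rule converse_rtranclp_into_rtranclp)
  qed simp
  have "(\<lambda>x y. 0 < bilateral_rate lH lE c p x y)\<^sup>*\<^sup>* (h, e) (0, 0)" for h e
  proof (induction h)
    case (Suc h)
    have "0 < bilateral_rate lH lE c p (Suc h, e) (h, e)"
      using lH lE pos[of h] powers(1,2)[of "Suc h"]
      by (simp del: power_Suc) (intro add_nonneg_pos mult_pos_pos mult_nonneg_nonneg; simp del: power_Suc)
    then show ?case using Suc by (rule converse_rtranclp_into_rtranclp)
  qed (use e in simp)
  then show ?thesis by (cases x) simp
qed

section \<open>Quadratic Lyapunov function for BilateralMatch(H)\<close>

text \<open>\<open>As\<close> is the value of (1 - c p)^h at balance and \<open>hs\<close> the real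
  h attaining it, so the centre is exact for each p; \<open>y\<close> bounds p \<open>hs\<close> and
  is its limit. \<open>K\<close> lets the E part pay the cross term in A e and leave the summand A e
  of \<open>f\<close>. No constant in \<open>b\<close> involves p.\<close>

definition As :: real where "As = 1 - lH / lE"
definition hs :: real where "hs = ln As / ln (1 - c * p)"
definition y :: real where "y = - ln As / c"
definition a :: real where "a = - ln (1 - c * p)"
definition K :: real where "K = (2 * lH * y / As + 1) / (2 * lE)"
definition b :: real where "b = 2 * lH + lE + 4 * lH * y\<^sup>2 + K * lE * (4 / c\<^sup>2 + 1)"

definition f :: "state \<Rightarrow> real" where
  "f = (\<lambda>(h, e). 2 * lE * ((real h - hs) * (As - (1 - c * p) ^ h)) + (1 - c * p) ^ h * real e)"

lemma As: "0 < As" "As < 1" "lE * (1 - As) = lH" using lH lE by (auto simp: As_def)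

lemma a: "c * p \<le> a" "0 < a"
proof -
  show "c * p \<le> a" unfolding a_def using probs(3) ln_le_minus_one[of "1 - c * p"] by simp
  then show "0 < a" using c p mult_pos_pos[of c p] by linarith
qed

lemma hs_eq: "hs = - ln As / a" by (simp add: hs_def a_def)

lemma lnAs: "ln As < 0" using As by simp

lemma y_pos: "0 < y" using lnAs c by (simp add: y_def divide_neg_pos)

lemma K_pos: "0 < K"
  using lH lE y_pos As by (simp add: K_def add_nonneg_pos)

lemma hs_pos: "0 < hs" using lnAs a by (simp add: hs_eq divide_neg_pos)

lemma p_hs_le: "p * hs \<le> y"
proof -
  have "hs \<le> - ln As / (c * p)" unfolding hs_eq
    using lnAs a c p by (intro divide_left_mono mult_pos_pos) auto
  then have "p * hs \<le> p * (- ln As / (c * p))" using p by (intro mult_left_mono) auto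
  also have "\<dots> = y" using p c by (simp add: y_def)
  finally show ?thesis .
qed

lemma power_eq_exp: "(1 - c * p) ^ h = As * exp (- a * (real h - hs))"
proof -
  have "(1 - c * p) ^ h = exp (ln (1 - c * p)) ^ h" using probs(3) by simp
  also have "\<dots> = exp (- a * real h)" by (simp add: a_def exp_of_nat_mult[symmetric] mult.commute)
  also have "\<dots> = exp (ln As + - a * (real h - hs))" using a by (simp add: hs_eq field_simps)
  also have "\<dots> = As * exp (- a * (real h - hs))" using As by (simp only: exp_add exp_ln)
  finally show ?thesis .
qed

lemma gap_eq: "(real h - hs) * (As - (1 - c * p) ^ h)
    = As / a * ((a * (real h - hs)) * (1 - exp (- (a * (real h - hs)))))"
  using a by (simp add: power_eq_exp field_simps)

lemma f_nonneg: "0 \<le> f x"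
proof -
  obtain h e where x: "x = (h, e)" by (cases x)
  have "0 \<le> v * (1 - exp (- v))" for v :: real
    by (cases "0 \<le> v") (auto intro: mult_nonneg_nonneg mult_nonpos_nonpos)
  from this[of "a * (real h - hs)"] have "0 \<le> (real h - hs) * (As - (1 - c * p) ^ h)"
    unfolding gap_eq using As a by (intro mult_nonneg_nonneg[of "As / a"]) auto
  then show ?thesis unfolding x f_def using lH lE powers(3)[of h] by (simp add: less_imp_le)
qed

text \<open>With the no-edge probabilities A, q, B the drift of h is - lE (As - A) - lH (2 - q - q
  B). The second part is due to H arrivals that find a partner, a waiting H counting twice: she does
  not join, and he leaves. It points downwards, so it can hurt only below \<open>hs\<close>, where
  it is O(p (1 + e)) against a deviation of at most y / p. The resulting multiple of e is paid by
  the decay - 2 lE A e of the E part.\<close>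

lemma bilateral_drift:
  defines "V \<equiv> \<lambda>x::state. (real (fst x) - hs)\<^sup>2 + K * (real (snd x))\<^sup>2"
  shows "(\<Sum>z\<in>neighbours x. bilateral_rate lH lE c p x z * (V z - V x)) \<le> b - f x"
proof -
  obtain h e where x: "x = (h, e)" by (cases x)
  define u where "u = real h - hs"
  define A where "A = (1 - c * p) ^ h"
  define B where "B = (1 - c * p) ^ e"
  define q where "q = (1 - p\<^sup>2) ^ h"
  define \<rho> where "\<rho> = (1 - c\<^sup>2) ^ e"
  have A: "0 < A" "A \<le> 1" and B: "0 < B" "B \<le> 1" and q: "0 \<le> q" "q \<le> 1" and \<rho>: "0 \<le> \<rho>" "\<rho> \<le> 1"
    using powers by (auto simp: A_def B_def q_def \<rho>_def)
  have dH: "downH h * ((real (h - 1) - hs)\<^sup>2 - u\<^sup>2) = downH h * (1 - 2 * u)"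
    by (cases h) (auto simp: downH_def u_def power2_eq_square algebra_simps)
  have dE: "downE h e * ((real (e - 1))\<^sup>2 - (real e)\<^sup>2) = downE h e * (1 - 2 * real e)"
    by (cases e) (auto simp: downE_def power2_eq_square algebra_simps)
  have "(\<Sum>z\<in>neighbours x. bilateral_rate lH lE c p x z * (V z - V x))
      = upH h e * (2 * u + 1) + downH h * ((real (h - 1) - hs)\<^sup>2 - u\<^sup>2)
        + K * (upE h e * (2 * real e + 1) + downE h e * ((real (e - 1))\<^sup>2 - (real e)\<^sup>2))"
    unfolding x bilateral_sum V_def by (simp add: u_def power2_eq_square algebra_simps)
  also have "\<dots> = (upH h e * (2 * u + 1) + downH h * (1 - 2 * u))
        + K * (upE h e * (2 * real e + 1) + downE h e * (1 - 2 * real e))"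
    by (simp only: dH dE)
  also have "\<dots> \<le> (2 * lH + lE + 4 * lH * y\<^sup>2 + 2 * lH * y / As * (A * real e) - 2 * lE * (u * (As - A)))
        + K * (lE * (4 / c\<^sup>2 + 1) - 2 * lE * (A * real e))"
  proof (rule add_mono)
    have err: "- u * (2 - q - q * B) \<le> 2 * y\<^sup>2 + y * (A * real e / As)"
    proof (cases "0 \<le> u")
      case True
      have "0 \<le> u * (2 - q - q * B)" using True q B mult_le_one[of q B] by (intro mult_nonneg_nonneg) auto
      moreover have "0 \<le> 2 * y\<^sup>2 + y * (A * real e / As)" using A As y_pos by simp
      ultimately show ?thesis by simp
    next
      case False
      \<comment> \<open>Below \<open>hs\<close> the E pool is drained at a rate bounded below, so a
        bare e may be charged to A e.\<close>
      have "As \<le> A" using False a As by (simp add: A_def power_eq_exp mult_le_cancel_left1 mult_nonneg_nonpos u_def[symmetric])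
      then have e: "real e \<le> A * real e / As" using As by (simp add: pos_le_divide_eq mult.commute[of A] mult_left_mono)
      have hh: "real h \<le> hs" "- u \<le> hs" using False by (auto simp: u_def)
      have "1 - q \<le> p\<^sup>2 * real h"
        using Bernoulli_inequality[of "- p\<^sup>2" h] probs(1) by (simp add: q_def mult.commute)
      also have "\<dots> \<le> p\<^sup>2 * hs" using hh by (intro mult_left_mono) auto
      finally have 1: "1 - q \<le> p\<^sup>2 * hs" .
      have "1 - B \<le> (c * p) * real e"
        using Bernoulli_inequality[of "- (c * p)" e] probs(3) by (simp add: B_def mult.commute)
      also have "\<dots> \<le> p * real e" using c p by (intro mult_right_mono) (auto simp: mult_left_le_one_le)
      finally have 2: "1 - B \<le> p * real e" .
      have "2 - q - q * B = 2 * (1 - q) + q * (1 - B)" by (simp add: algebra_simps)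
      also have "\<dots> \<le> 2 * (p\<^sup>2 * hs) + 1 * (p * real e)"
        using 1 2 q B by (intro add_mono mult_mono mult_left_mono) auto
      finally have "(- u) * (2 - q - q * B) \<le> hs * (2 * (p\<^sup>2 * hs) + p * real e)"
        using hh hs_pos q B mult_le_one[of q B] by (intro mult_mono) auto
      also have "\<dots> = 2 * (p * hs)\<^sup>2 + (p * hs) * real e" by (simp add: power2_eq_square algebra_simps)
      also have "\<dots> \<le> 2 * y\<^sup>2 + y * real e"
        using p_hs_le hs_pos p by (intro add_mono mult_left_mono mult_right_mono power_mono) auto
      also have "\<dots> \<le> 2 * y\<^sup>2 + y * (A * real e / As)" using e y_pos by (intro add_mono mult_left_mono) auto
      finally show ?thesis by simp
    qed
    have "upH h e * (2 * u + 1) + downH h * (1 - 2 * u)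
       = (upH h e + downH h) + 2 * lH * (- u * (2 - q - q * B)) - 2 * u * (lE - lE * A - lH)"
      by (simp add: upH_def downH_def A_def[symmetric] B_def[symmetric] q_def[symmetric] algebra_simps)
    also have "2 * u * (lE - lE * A - lH) = 2 * lE * (u * (As - A))"
      using arg_cong[OF As(3), of "\<lambda>t. 2 * u * t"] by (simp add: algebra_simps)
    also have "upH h e + downH h \<le> 2 * lH + lE" using rates_le(1)[of h e] rates_le(2)[of h] by linarith
    also have "2 * lH * (- u * (2 - q - q * B)) \<le> 2 * lH * (2 * y\<^sup>2 + y * (A * real e / As))"
      using err lH by (intro mult_left_mono) auto
    finally show "upH h e * (2 * u + 1) + downH h * (1 - 2 * u)
        \<le> 2 * lH + lE + 4 * lH * y\<^sup>2 + 2 * lH * y / As * (A * real e) - 2 * lE * (u * (As - A))"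
      by (simp add: algebra_simps)
  next
    have \<rho>e: "real e * \<rho> \<le> 1 / c\<^sup>2" using of_nat_mult_power_le[of "1 - c\<^sup>2" e] probs by (simp add: \<rho>_def)
    \<comment> \<open>At e = 0 the factor 1 - B vanishes; for e \<ge> 1 the last factor is
      negative.\<close>
    have neg: "lH * q * (1 - B) * (1 - 2 * real e) \<le> 0"
    proof (cases e)
      case (Suc n)
      then show ?thesis using lH q B by (intro mult_nonneg_nonpos) auto
    qed (simp add: B_def)
    have "upE h e * (2 * real e + 1) + downE h e * (1 - 2 * real e)
       = lE * A * (4 * (real e * \<rho>) + 1 - 2 * real e) + lH * q * (1 - B) * (1 - 2 * real e)"
      by (simp add: upE_def downE_def A_def[symmetric] B_def[symmetric] q_def[symmetric] \<rho>_def[symmetric] algebra_simps)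
    also have "\<dots> \<le> lE * A * (4 * (1 / c\<^sup>2) + 1 - 2 * real e) + 0"
      using neg \<rho>e lE lH A by (intro add_mono mult_left_mono) auto
    also have "\<dots> = lE * A * (4 / c\<^sup>2 + 1) - 2 * lE * (A * real e)" by (simp add: algebra_simps)
    also have "lE * A * (4 / c\<^sup>2 + 1) \<le> lE * (4 / c\<^sup>2 + 1)"
      using lE lH A by (intro mult_right_mono) auto
    finally show "K * (upE h e * (2 * real e + 1) + downE h e * (1 - 2 * real e))
        \<le> K * (lE * (4 / c\<^sup>2 + 1) - 2 * lE * (A * real e))"
      using K_pos by (intro mult_left_mono) auto
  qed
  also have "\<dots> = b - f x"
  proof -
    have "K * (2 * lE * (A * real e)) = 2 * lH * y / As * (A * real e) + A * real e"
      using lE lH by (simp add: K_def field_simps)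
    then show ?thesis by (simp add: b_def f_def x A_def[symmetric] u_def[symmetric] right_diff_distrib)
  qed
  finally show ?thesis .
qed

text \<open>Beyond hs + 1 the gap As - (1 - c p)^h stays above As c p, so f grows linearly in h. The
  coefficient of e decays with h, so the bound on e is chosen after h: hence a dependent
  product.\<close>

lemma f_level: "finite {x. f x \<le> M}"
proof -
  define \<kappa> where "\<kappa> = 2 * lE * (As * (c * p))"
  have \<kappa>: "0 < \<kappa>" using lE lH As c p by (simp add: \<kappa>_def)
  define H where "H = nat \<lceil>hs + 1 + \<bar>M\<bar> / \<kappa>\<rceil>"
  have "{x. f x \<le> M} \<subseteq> (SIGMA h:{..H}. {..nat \<lceil>M / (1 - c * p) ^ h\<rceil>})"
  proof
    fix x assume "x \<in> {x. f x \<le> M}"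
    then have fx: "f x \<le> M" by simp
    obtain h e where x: "x = (h, e)" by (cases x)
    have gap: "0 \<le> 2 * lE * ((real h - hs) * (As - (1 - c * p) ^ h))"
      using f_nonneg[of "(h, 0)"] by (simp add: f_def)
    have Ae: "0 \<le> (1 - c * p) ^ h * real e" using powers by (simp add: less_imp_le)
    have "(1 - c * p) ^ h * real e \<le> M" using fx gap by (simp add: x f_def)
    then have "real e \<le> M / (1 - c * p) ^ h" using powers(3)[of h] by (simp add: pos_le_divide_eq mult.commute)
    then have "e \<le> nat \<lceil>M / (1 - c * p) ^ h\<rceil>" by linarith
    moreover have "h \<le> H"
    proof (cases "real h \<le> hs + 1")
      case True
      then have "real h \<le> hs + 1 + \<bar>M\<bar> / \<kappa>" using \<kappa> by (smt (verit) divide_nonneg_pos)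
      then show ?thesis unfolding H_def by linarith
    next
      case False
      have "exp (- a * (real h - hs)) \<le> exp (- a)" using False a by (simp add: mult_le_cancel_left1)
      also have "exp (- a) = 1 - c * p" using probs(3) by (simp add: a_def)
      finally have "As * exp (- a * (real h - hs)) \<le> As * (1 - c * p)"
        using As by (intro mult_left_mono) auto
      then have "As * (c * p) \<le> As - (1 - c * p) ^ h" unfolding power_eq_exp by (simp add: algebra_simps)
      then have "2 * lE * ((real h - hs) * (As * (c * p))) \<le> 2 * lE * ((real h - hs) * (As - (1 - c * p) ^ h))"
        using lE lH False by (intro mult_left_mono) auto
      also have "\<dots> \<le> \<bar>M\<bar>" using fx Ae by (simp add: x f_def)
      finally have "(real h - hs) * \<kappa> \<le> \<bar>M\<bar>" by (simp only: \<kappa>_def mult_ac)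
      then have "real h - hs \<le> \<bar>M\<bar> / \<kappa>" using \<kappa> by (simp add: pos_le_divide_eq)
      then show ?thesis unfolding H_def by linarith
    qed
    ultimately show "x \<in> (SIGMA h:{..H}. {..nat \<lceil>M / (1 - c * p) ^ h\<rceil>})" by (simp add: x)
  qed
  then show ?thesis by (rule finite_subset) auto
qed

lemma b_nonneg: "0 \<le> b"
  using K_pos lH lE by (simp add: b_def)

lemma bilateral_mean_le: "(\<integral>\<^sup>+x. ennreal (f x) \<partial>steady_state (bilateral_rate lH lE c p)) \<le> ennreal b"
proof -
  let ?V = "\<lambda>x::state. (real (fst x) - hs)\<^sup>2 + K * (real (snd x))\<^sup>2"
  have "- 0 \<le> ?V x" for x using K_pos by simp
  from steady_state_drift_bound[where V = ?V and f = f, OF this f_nonneg b_nonneg bilateral_drift f_level bilateral_reach]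
  show ?thesis .
qed

text \<open>The deviation is measured as v = a (h - hs). As p / a \<le> 1 / c, a tolerance c
  \<delta> for v becomes \<delta> for p h.\<close>

lemma bilateral_close:
  assumes "0 < \<delta>"
  shows "\<bar>p * real (fst x) - p * hs\<bar> \<le> \<delta> + 1 / (2 * lE * As * (1 - exp (- (c * \<delta>)))) * p * f x"
proof -
  obtain h e where x: "x = (h, e)" by (cases x)
  define v where "v = a * (real h - hs)"
  define d where "d = 1 - exp (- (c * \<delta>))"
  have d: "0 < d" using assms c by (simp add: d_def)
  have pa: "p / a \<le> 1 / c" using a c p by (simp add: field_simps)
  have "\<bar>p * real h - p * hs\<bar> = p / a * \<bar>v\<bar>"
    using p a by (simp add: v_def abs_mult right_diff_distrib[symmetric])
  also have "\<dots> \<le> p / a * (c * \<delta> + v * (1 - exp (- v)) / d)"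
    unfolding d_def using p a assms c by (intro mult_left_mono abs_le_mult_one_minus_exp) auto
  also have "\<dots> = p / a * (c * \<delta>) + p / a * (v * (1 - exp (- v)) / d)" by (simp add: algebra_simps)
  also have "p / a * (c * \<delta>) \<le> 1 / c * (c * \<delta>)" using pa assms c by (intro mult_right_mono) auto
  also have "1 / c * (c * \<delta>) = \<delta>" using c by simp
  also have "p / a * (v * (1 - exp (- v)) / d)
      = 1 / (2 * lE * As * d) * p * (2 * lE * ((real h - hs) * (As - (1 - c * p) ^ h)))"
    unfolding gap_eq v_def[symmetric] using As lE lH d a by (simp add: field_simps)
  also have "\<dots> \<le> 1 / (2 * lE * As * d) * p * f x"
    using As lE lH d p powers(3)[of h] by (intro mult_left_mono) (auto simp: f_def x less_imp_le)
  finally show ?thesis by (simp add: x d_def)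
qed

end

lemma bilateral_tendsto:
  assumes lH: "0 < lH" and lE: "lH < lE" and c: "0 < c" "c \<le> (1::real)"
  shows "((\<lambda>p. ennreal p * waiting_time_H lH (bilateral_rate lH lE c p))
    \<longlongrightarrow> ennreal (- ln (1 - lH / lE) / c / lH)) (at_right 0)"
proof (rule waiting_time_tendsto)
  have loc: "\<forall>\<^sub>F p in at_right (0::real). bilateral_match lH lE c p"
    using assms by (auto simp: bilateral_match_def eventually_at_right[of 0 "1::real"])
  let ?g = "\<lambda>p. bilateral_match.f lH lE c p" and ?C = "bilateral_match.b lH lE c" and ?h = "\<lambda>p. bilateral_match.hs lH lE c p"
  show "0 < lH" by fact
  show "\<forall>\<^sub>F p in at_right 0. (\<forall>x. 0 \<le> ?g p x) \<and>
      (\<integral>\<^sup>+x. ennreal (?g p x) \<partial>steady_state (bilateral_rate lH lE c p)) \<le> ennreal ?C"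
    using loc by eventually_elim (simp add: bilateral_match.f_nonneg bilateral_match.bilateral_mean_le)
  show "\<forall>\<^sub>F p in at_right 0. 0 \<le> ?h p"
    using loc by eventually_elim (simp add: bilateral_match.hs_pos less_imp_le)
  \<comment> \<open>The constant does not depend on p, so its sign may be checked at any admissible
    value.\<close>
  show "0 \<le> ?C"
    by (rule bilateral_match.b_nonneg[of _ _ _ "1 / 2"]) (use assms in \<open>simp add: bilateral_match_def\<close>)
  show "\<exists>K\<ge>0. \<forall>\<^sub>F p in at_right 0. \<forall>x. \<bar>p * real (fst x) - p * ?h p\<bar> \<le> \<delta> + K * p * ?g p x"
    if "0 < \<delta>" for \<delta>
  proof (intro exI conjI)
    let ?K = "1 / (2 * lE * bilateral_match.As lH lE * (1 - exp (- (c * \<delta>))))"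
    have "bilateral_match lH lE c (1 / 2)" using assms by (simp add: bilateral_match_def)
    then have "0 < bilateral_match.As lH lE" by (rule bilateral_match.As)
    then show "0 \<le> ?K" using that assms by simp
    show "\<forall>\<^sub>F p in at_right 0. \<forall>x. \<bar>p * real (fst x) - p * ?h p\<bar> \<le> \<delta> + ?K * p * ?g p x"
      using loc by eventually_elim (intro allI bilateral_match.bilateral_close that)
  qed
  show "((\<lambda>p. p * ?h p) \<longlongrightarrow> - ln (1 - lH / lE) / c) (at_right 0)"
  proof -
    have "((\<lambda>p. p * (L / ln (1 - c * p))) \<longlongrightarrow> - (L * inverse c)) (at_right 0)" for L
      using c by real_asymp
    then have "((\<lambda>p. p * (ln (1 - lH / lE) / ln (1 - c * p))) \<longlongrightarrow> - ln (1 - lH / lE) / c) (at_right 0)"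
      by (simp add: divide_inverse)
    moreover have "\<forall>\<^sub>F p in at_right 0. p * (ln (1 - lH / lE) / ln (1 - c * p)) = p * ?h p"
      using loc by eventually_elim (simp add: bilateral_match.hs_def bilateral_match.As_def)
    ultimately show ?thesis by (rule Lim_transform_eventually)
  qed
qed

section \<open>ChainMatch(d)\<close>

lemma expectation_some_edge_bind:
  fixes F :: "'a \<Rightarrow> real"
  assumes p: "0 \<le> p" "p \<le> 1" and fin: "\<And>b. finite (set_pmf (f b))"
  shows "measure_pmf.expectation (bind_pmf (some_edge n p) f) F
    = (1 - (1 - p) ^ n) * measure_pmf.expectation (f True) F + (1 - p) ^ n * measure_pmf.expectation (f False) F"
proof -
  have "0 \<le> (1 - p) ^ n" "(1 - p) ^ n \<le> 1" using p by (auto intro: power_le_one)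
  then show ?thesis
    using fin by (subst pmf_expectation_bind[where A=UNIV]) (auto simp: some_edge_def UNIV_bool)
qed

text \<open>A single unfolding of the recursion, to be used instantiated; as a rewrite rule the
  defining equation would loop.\<close>

lemma in_set_pmf_chain_segment_iff:
  "x \<in> set_pmf (chain_segment pE pH h e) \<longleftrightarrow>
    True \<in> set_pmf (some_edge h pH) \<and> x \<in> set_pmf (chain_segment pE pH (h - 1) e) \<or>
    False \<in> set_pmf (some_edge h pH) \<and>
      (True \<in> set_pmf (some_edge e pE) \<and> x \<in> set_pmf (chain_segment pE pH h (e - 1)) \<or>
       False \<in> set_pmf (some_edge e pE) \<and> x = (h, e))"
  by (subst chain_segment.simps) (auto simp: Bex_def ex_bool_eq)

lemma set_pmf_chain_segment: "set_pmf (chain_segment pE pH h e) \<subseteq> {..h} \<times> {..e}"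
proof (induction pE pH h e rule: chain_segment.induct)
  case (1 pE pH h e)
  show ?case
  proof
    fix x assume "x \<in> set_pmf (chain_segment pE pH h e)"
    then consider "True \<in> set_pmf (some_edge h pH)" "x \<in> set_pmf (chain_segment pE pH (h - 1) e)"
      | "False \<in> set_pmf (some_edge h pH)" "True \<in> set_pmf (some_edge e pE)" "x \<in> set_pmf (chain_segment pE pH h (e - 1))"
      | "x = (h, e)"
      unfolding in_set_pmf_chain_segment_iff[of x pE pH h e] by blast
    then show "x \<in> {..h} \<times> {..e}"
      by cases (use 1 in fastforce)+
  qed
qed

lemma finite_chain_segment: "finite (set_pmf (chain_segment pE pH h e))"
  by (rule finite_subset[OF set_pmf_chain_segment]) auto

lemma expectation_chain_segment:
  fixes F :: "state \<Rightarrow> real"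
  assumes "0 \<le> pE" "pE \<le> 1" "0 \<le> pH" "pH \<le> 1"
  shows "measure_pmf.expectation (chain_segment pE pH h e) F
    = (1 - (1 - pH) ^ h) * measure_pmf.expectation (chain_segment pE pH (h - 1) e) F
      + (1 - pH) ^ h * ((1 - (1 - pE) ^ e) * measure_pmf.expectation (chain_segment pE pH h (e - 1)) F
          + (1 - pE) ^ e * F (h, e))"
proof -
  let ?f = "\<lambda>toE. if toE then chain_segment pE pH h (e - 1) else return_pmf (h, e)"
  have fin: "finite (set_pmf (?f b))" for b using finite_chain_segment by simp
  have inner: "measure_pmf.expectation (bind_pmf (some_edge e pE) ?f) F
      = (1 - (1 - pE) ^ e) * measure_pmf.expectation (chain_segment pE pH h (e - 1)) F + (1 - pE) ^ e * F (h, e)"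
    using assms fin by (subst expectation_some_edge_bind) auto
  let ?g = "\<lambda>toH. if toH then chain_segment pE pH (h - 1) e else bind_pmf (some_edge e pE) ?f"
  have "finite (set_pmf (bind_pmf (some_edge e pE) ?f))"
    unfolding set_bind_pmf by (intro finite_UN_I fin) simp
  then have fin': "finite (set_pmf (?g b))" for b using finite_chain_segment by (cases b) auto
  have "measure_pmf.expectation (chain_segment pE pH h e) F
      = measure_pmf.expectation (bind_pmf (some_edge h pH) ?g) F"
    by (subst chain_segment.simps) (rule refl)
  also have "\<dots> = (1 - (1 - pH) ^ h) * measure_pmf.expectation (?g True) F
      + (1 - pH) ^ h * measure_pmf.expectation (?g False) F"
    by (rule expectation_some_edge_bind[OF assms(3,4) fin'])
  finally show ?thesis by (simp only: if_True if_False inner)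
qed

text \<open>Comparison principle: the expectation solves the one-step recursion with equality, so
  every supersolution X dominates it. At h = 0 or e = 0 the predecessor term has weight 0.\<close>

lemma expectation_chain_segment_le:
  fixes F :: "state \<Rightarrow> real" and X :: "nat \<Rightarrow> nat \<Rightarrow> real"
  assumes pr: "0 \<le> pE" "pE \<le> 1" "0 \<le> pH" "pH \<le> 1"
    and super: "\<And>h e. (1 - (1 - pH) ^ h) * X (h - 1) e
      + (1 - pH) ^ h * ((1 - (1 - pE) ^ e) * X h (e - 1) + (1 - pE) ^ e * F (h, e)) \<le> X h e"
  shows "measure_pmf.expectation (chain_segment pE pH h e) F \<le> X h e"
proof (induction "h + e" arbitrary: h e rule: less_induct)
  case less
  let ?S = "\<lambda>h e. measure_pmf.expectation (chain_segment pE pH h e) F"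
  have P: "0 \<le> 1 - (1 - pH) ^ h" "0 \<le> (1 - pH) ^ h" "0 \<le> 1 - (1 - pE) ^ e"
    using pr by (auto intro: power_le_one)
  have 1: "(1 - (1 - pH) ^ h) * ?S (h - 1) e \<le> (1 - (1 - pH) ^ h) * X (h - 1) e"
    using less[of "h - 1" e] P by (cases h) (auto intro: mult_left_mono)
  have 2: "(1 - (1 - pE) ^ e) * ?S h (e - 1) \<le> (1 - (1 - pE) ^ e) * X h (e - 1)"
    using less[of h "e - 1"] P by (cases e) (auto intro: mult_left_mono)
  have "?S h e = (1 - (1 - pH) ^ h) * ?S (h - 1) e
      + (1 - pH) ^ h * ((1 - (1 - pE) ^ e) * ?S h (e - 1) + (1 - pE) ^ e * F (h, e))"
    by (rule expectation_chain_segment) fact+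
  also have "\<dots> \<le> (1 - (1 - pH) ^ h) * X (h - 1) e
      + (1 - pH) ^ h * ((1 - (1 - pE) ^ e) * X h (e - 1) + (1 - pE) ^ e * F (h, e))"
    by (rule add_mono[OF 1 mult_left_mono[OF add_right_mono[OF 2] P(2)]])
  also have "\<dots> \<le> X h e" by (rule super)
  finally show ?case .
qed

lemma True_in_some_edge:
  assumes "0 < p" "p \<le> 1" "0 < n"
  shows "True \<in> set_pmf (some_edge n p)"
proof -
  have "(1 - p) ^ n \<le> (1 - p) ^ 1" using assms by (intro power_decreasing) auto
  moreover have "0 \<le> (1 - p) ^ n" using assms by simp
  ultimately have "(1 - p) ^ n < 1" "0 \<le> (1 - p) ^ n" using assms by auto
  then show ?thesis by (simp add: some_edge_def set_pmf_iff)
qed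

lemma False_in_some_edge_0: "False \<in> set_pmf (some_edge 0 p)"
  by (simp add: some_edge_def set_pmf_iff)

text \<open>A segment may collect all H agents and then all E agents; at (0, 0) it must
  stop.\<close>

lemma zero_in_chain_segment:
  assumes "0 < pE" "pE \<le> 1" "0 < pH" "pH \<le> 1"
  shows "(0, 0) \<in> set_pmf (chain_segment pE pH h e)"
proof (induction h)
  case 0
  show ?case
  proof (induction e)
    case 0
    show ?case
      unfolding in_set_pmf_chain_segment_iff[of _ pE pH 0 0] using False_in_some_edge_0 by blast
  next
    case (Suc e)
    then show ?case
      unfolding in_set_pmf_chain_segment_iff[of _ pE pH 0 "Suc e"]
      using True_in_some_edge[OF assms(1,2), of "Suc e"] False_in_some_edge_0 by simp
  qed
next
  case (Suc h)
  then show ?case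
    unfolding in_set_pmf_chain_segment_iff[of _ pE pH "Suc h" e]
    using True_in_some_edge[OF assms(3,4), of "Suc h"] by simp
qed

section \<open>The generator of ChainMatch(d)\<close>

locale chain_match =
  fixes lH lE c p :: real and d :: nat
  assumes lH: "0 < lH" and lE: "0 < lE" and c: "0 < c" "c \<le> 1" and p: "0 < p" "p \<le> 1 / 2" and d: "1 \<le> d"
begin

definition box :: "state \<Rightarrow> state set" where
  "box = (\<lambda>(h, e). {..h + 1} \<times> {..e + 1})"

abbreviation seg :: "(state \<Rightarrow> real) \<Rightarrow> nat \<Rightarrow> nat \<Rightarrow> real" where
  "seg F h e \<equiv> measure_pmf.expectation (chain_segment c p h e) F"

definition qH :: real where "qH = 1 - (1 - p) ^ d"
definition q :: real where "q = 1 - (1 - c) ^ d"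

lemma q: "0 < q" "q \<le> 1"
  using c d power_decreasing[of 1 d "1 - c"] by (auto simp: q_def)

text \<open>The last bound is the union bound: an H arrival meets a bridge agent with probability
  O(p) only, so her starting a segment is an error term, in contrast to the fixed \<open>q\<close>
  for E arrivals.\<close>

lemma qH: "0 \<le> qH" "qH \<le> 1" "qH \<le> real d * p"
  using p power_le_one[of "1 - p" d] Bernoulli_inequality[of "- p" d] by (auto simp: qH_def)

lemma set_arrivals: "set_pmf (chain_arrival_H d c p x) \<subseteq> box x" "set_pmf (chain_arrival_E d c p x) \<subseteq> box x"
proof -
  obtain h e where x: "x = (h, e)" by (cases x)
  show "set_pmf (chain_arrival_H d c p x) \<subseteq> box x" "set_pmf (chain_arrival_E d c p x) \<subseteq> box x"
    using set_pmf_chain_segment[of c p h e]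
    by (auto simp: x chain_arrival_H_def chain_arrival_E_def box_def split: if_splits) (force+)?
qed

lemma finite_box: "finite (box x)"
  by (cases x) (simp add: box_def)

lemma chain_sum:
  fixes V :: "state \<Rightarrow> real"
  shows "(\<Sum>y\<in>box x. chain_rate d lH lE c p x y * (V y - V x))
    = lH * (measure_pmf.expectation (chain_arrival_H d c p x) V - V x)
      + lE * (measure_pmf.expectation (chain_arrival_E d c p x) V - V x)"
proof -
  have E: "(\<Sum>y\<in>box x. pmf M y * (V y - V x)) = measure_pmf.expectation M V - V x"
    if "set_pmf M \<subseteq> box x" for M
    using that sum_pmf_eq_1[OF finite_box that]
    by (subst integral_measure_pmf_real[OF finite_box])
      (auto simp: right_diff_distrib sum_subtractf sum_distrib_left[symmetric] mult.commute)
  have "(\<Sum>y\<in>box x. chain_rate d lH lE c p x y * (V y - V x))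
    = lH * (\<Sum>y\<in>box x. pmf (chain_arrival_H d c p x) y * (V y - V x))
      + lE * (\<Sum>y\<in>box x. pmf (chain_arrival_E d c p x) y * (V y - V x))"
    by (simp add: chain_rate_def distrib_right sum.distrib sum_distrib_left mult.assoc)
  then show ?thesis by (simp add: E set_arrivals)
qed

sublocale finite_jump_rates "chain_rate d lH lE c p" box "lH + lE"
proof
  show nonneg: "0 \<le> chain_rate d lH lE c p x y" for x y
    using lH lE by (simp add: chain_rate_def)
  show "finite (box x)" for x by (rule finite_box)
  show "chain_rate d lH lE c p x y = 0" if "y \<notin> box x" for x y
    using that set_arrivals[of x] by (simp add: chain_rate_def) (metis set_pmf_iff subsetD mult_zero_right add_0)
  show "(\<Sum>y\<in>box x - {x}. chain_rate d lH lE c p x y) \<le> lH + lE" for x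
  proof -
    have "(\<Sum>y\<in>box x - {x}. chain_rate d lH lE c p x y) \<le> (\<Sum>y\<in>box x. chain_rate d lH lE c p x y)"
      using nonneg finite_box by (intro sum_mono2) auto
    also have "\<dots> = lH * (\<Sum>y\<in>box x. pmf (chain_arrival_H d c p x) y) + lE * (\<Sum>y\<in>box x. pmf (chain_arrival_E d c p x) y)"
      by (simp add: chain_rate_def sum.distrib sum_distrib_left)
    also have "\<dots> = lH + lE" by (simp add: sum_pmf_eq_1 finite_box set_arrivals)
    finally show ?thesis .
  qed
  show "0 < lH + lE" using lH lE by simp
qed

text \<open>One jump suffices, namely an E arrival starting a segment that empties the
  market.\<close>

lemma chain_reach: "(\<lambda>x y. 0 < chain_rate d lH lE c p x y)\<^sup>*\<^sup>* x (0, 0)"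
proof -
  obtain h e where x: "x = (h, e)" by (cases x)
  have "True \<in> set_pmf (some_edge d c)" using c d by (intro True_in_some_edge) auto
  moreover have "(0, 0) \<in> set_pmf (chain_segment c p h e)" using c p by (intro zero_in_chain_segment) auto
  ultimately have "(0, 0) \<in> set_pmf (chain_arrival_E d c p x)"
    by (auto simp: x chain_arrival_E_def intro!: bexI[of _ True])
  then have "0 < pmf (chain_arrival_E d c p x) (0, 0)" by (simp add: pmf_positive)
  then have "0 < chain_rate d lH lE c p x (0, 0)"
    using lH lE by (simp add: chain_rate_def add_nonneg_pos)
  then show ?thesis by (rule r_into_rtranclp)
qed

lemma chain_generator:
  "(\<Sum>y\<in>box (h, e). chain_rate d lH lE c p (h, e) y * (V y - V (h, e)))
    = lH * ((1 - qH) * (V (h + 1, e) - V (h, e)) + qH * (seg V h e - V (h, e)))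
      + lE * ((1 - q) * (V (h, e + 1) - V (h, e)) + q * (seg V h e - V (h, e)))"
proof -
  have H: "measure_pmf.expectation (chain_arrival_H d c p (h, e)) V = qH * seg V h e + (1 - qH) * V (h + 1, e)"
    unfolding chain_arrival_H_def using p finite_chain_segment
    by (simp, subst expectation_some_edge_bind) (auto simp: qH_def)
  have E: "measure_pmf.expectation (chain_arrival_E d c p (h, e)) V = q * seg V h e + (1 - q) * V (h, e + 1)"
    unfolding chain_arrival_E_def using c finite_chain_segment
    by (simp, subst expectation_some_edge_bind) (auto simp: q_def)
  show ?thesis unfolding chain_sum H E by (simp add: algebra_simps)
qed

section \<open>The corrected potential and its drift\<close>

definition z :: "nat \<Rightarrow> real" where "z h = (1 - p) ^ h"
text \<open>1 / \<gamma> is the value of \<open>z\<close> at the fluid balance, so 1 - \<gamma> z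
  measures the distance from it.\<close>

definition \<gamma> :: real where "\<gamma> = 1 + lH / lE"
definition a :: real where "a = - ln (1 - p)"

lemma z: "0 < z h" "z h \<le> 1" "z (Suc h) = (1 - p) * z h"
  using p by (auto simp: z_def power_le_one)

lemma z_0: "z 0 = 1"
  by (simp add: z_def)

lemma \<gamma>: "1 < \<gamma>" "lE * (\<gamma> - 1) = lH"
  using lH lE by (auto simp: \<gamma>_def)

lemma a: "p \<le> a" "a \<le> 2 * p" "0 < a"
proof -
  show "p \<le> a" unfolding a_def using p ln_le_minus_one[of "1 - p"] by simp
  then show "0 < a" using p by simp
  have "a = ln (1 / (1 - p))" using p by (simp add: a_def ln_div)
  also have "\<dots> \<le> 1 / (1 - p) - 1" using p by (intro ln_le_minus_one) auto
  also have "\<dots> = p / (1 - p)" using p by (simp add: field_simps)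
  also have "\<dots> \<le> p / (1 / 2)" using p by (intro divide_left_mono) auto
  finally show "a \<le> 2 * p" by simp
qed

lemma z_eq_exp: "z h = exp (- (a * real h))"
proof -
  have "z h = exp (ln (1 - p)) ^ h" using p by (simp add: z_def)
  then show ?thesis by (simp add: a_def exp_of_nat_mult[symmetric] mult.commute)
qed

text \<open>
  A run of H agents maps \<open>F + G\<close> to \<open>F\<close>, because \<open>(1 - z) w = z G\<close>. The corrector \<open>- e G\<close> averages
  over the random number of runs in a segment, which is one more than the number of E agents it
  collects. The polynomial form of \<open>w\<close> makes the increments of \<open>G\<close> of order \<open>p z\<close>, so that the
  value of \<open>G\<close> changes only by \<open>O(p)\<close> during a run, uniformly in \<open>h\<close>.
\<close>

definition w :: "nat \<Rightarrow> real" where "w h = z h * (1 - \<gamma> * z h)"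
definition G :: "nat \<Rightarrow> real" where "G h = (1 - z h) * (1 - \<gamma> * z h)"
definition F :: "nat \<Rightarrow> real" where "F h = (\<Sum>k<h. w (Suc k))"
definition \<Phi> :: "state \<Rightarrow> real" where "\<Phi> = (\<lambda>(h, e). F h + G h - real e * G h)"

lemma abs_le_\<gamma>: "\<bar>1 - \<gamma> * z h\<bar> \<le> \<gamma>"
proof -
  have "\<gamma> * z h \<le> \<gamma> * 1" "0 \<le> \<gamma> * z h" using z[of h] \<gamma> by (intro mult_left_mono mult_nonneg_nonneg; simp)+
  then show ?thesis using \<gamma>(1) by linarith
qed

lemma G_le: "\<bar>G h\<bar> \<le> \<gamma>" and w_le: "\<bar>w h\<bar> \<le> \<gamma>"
  using z[of h] mult_mono[OF _ abs_le_\<gamma>[of h], of _ 1] by (auto simp: G_def w_def abs_mult)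

lemma G_step: "G (Suc h) - G h = p * z h * (1 + \<gamma> - \<gamma> * z h * (2 - p))"
  by (simp add: G_def z algebra_simps)

text \<open>The one-sided bound uses \<open>z\<close> at the upper level because it will be paid
  from the probability that a run ends at that level; p \<le> 1/2 gives z h \<le> 2 z (Suc
  h).\<close>

lemma G_step_le: "G (Suc h) - G h \<le> 4 * \<gamma> * p * z (Suc h)" and G_step_abs: "\<bar>G (Suc h) - G h\<bar> \<le> 2 * \<gamma> * p"
proof -
  define R where "R = \<gamma> * z h * (2 - p)"
  have "\<gamma> * z h * (2 - p) \<le> \<gamma> * 1 * 2"
    using z[of h] \<gamma> p by (intro mult_mono; simp)
  then have R: "0 \<le> R" "R \<le> 2 * \<gamma>" using z[of h] \<gamma> p by (auto simp: R_def)
  have step: "G (Suc h) - G h = p * z h * (1 + \<gamma> - R)" by (simp add: G_step R_def)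
  have "G (Suc h) - G h \<le> p * z h * (2 * \<gamma>)"
    unfolding step using R z[of h] \<gamma>(1) p by (intro mult_left_mono) auto
  also have "\<dots> \<le> 4 * \<gamma> * p * z (Suc h)"
  proof -
    have "z h \<le> 2 * z (Suc h)" using z[of h] p mult_right_mono[of "1/2" "1 - p" "z h"] by simp
    then have "(p * (2 * \<gamma>)) * z h \<le> (p * (2 * \<gamma>)) * (2 * z (Suc h))" using \<gamma> p by (intro mult_left_mono) auto
    then show ?thesis by (simp add: mult_ac)
  qed
  finally show "G (Suc h) - G h \<le> 4 * \<gamma> * p * z (Suc h)" .
  have "\<bar>1 + \<gamma> - R\<bar> \<le> 2 * \<gamma>" using R \<gamma>(1) by linarith
  then have "\<bar>G (Suc h) - G h\<bar> \<le> (p * z h) * (2 * \<gamma>)"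
    unfolding step using z[of h] p by (simp add: abs_mult mult_left_mono)
  also have "\<dots> \<le> (p * 1) * (2 * \<gamma>)" using z[of h] p \<gamma> by (intro mult_right_mono mult_left_mono) auto
  finally show "\<bar>G (Suc h) - G h\<bar> \<le> 2 * \<gamma> * p" by (simp add: mult_ac)
qed

lemma w_step: "w (Suc h) \<le> w h + 2 * \<gamma> * p"
proof -
  have "w (Suc h) - w h = p * (\<gamma> * (z h * z h) * (2 - p) - z h)" by (simp add: w_def z algebra_simps)
  also have "\<dots> \<le> p * (\<gamma> * (1 * 1) * 2 - 0)"
    using z[of h] \<gamma> p by (intro mult_left_mono diff_mono mult_mono) auto
  finally show ?thesis by (simp add: mult_ac)
qed

text \<open>Supersolution whose quadratic term is a budget for the change of \<open>G\<close> during
  runs. Ending a run lowers the budget by 2 \<gamma> p (e (e + 1) - e (e - 1)) = 4 \<gamma> p e,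
  with weight z; this matches e times the increment of \<open>G\<close> allowed by
  \<open>G_step_le\<close>.\<close>

lemma seg_\<Phi>_le: "seg \<Phi> h e \<le> F h - real e * G h + 2 * \<gamma> * p * (real e * (real e + 1))"
proof (rule expectation_chain_segment_le[where X = "\<lambda>h e. F h - real e * G h + 2 * \<gamma> * p * (real e * (real e + 1))"])
  fix h e
  let ?X = "\<lambda>h e. F h - real e * G h + 2 * \<gamma> * p * (real e * (real e + 1))"
  define D where "D = (1 - c) ^ e"
  have D: "0 \<le> D" "D \<le> 1" using c by (auto simp: D_def power_le_one)
  have E: "(1 - D) * ?X h (e - 1) + D * \<Phi> (h, e)
      \<le> \<Phi> (h, e) + 2 * \<gamma> * p * (real e * (real e - 1))"
  proof (cases e)
    case (Suc n)
    define Y where "Y = 2 * \<gamma> * p * (real e * (real e - 1))"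
    \<comment> \<open>The point of the corrector: going on with e - 1 E agents is worth as much as
      stopping at e, up to the budget Y, so the probability D has no influence.\<close>
    have eq: "?X h (e - 1) = \<Phi> (h, e) + Y"
      by (simp add: Suc \<Phi>_def Y_def algebra_simps)
    have "0 \<le> Y" using \<gamma> p by (simp add: Suc Y_def)
    then have "(1 - D) * Y \<le> Y" using D by (intro mult_left_le_one_le) auto
    then have "(1 - D) * (\<Phi> (h, e) + Y) + D * \<Phi> (h, e) \<le> \<Phi> (h, e) + Y" by (simp add: algebra_simps)
    then show ?thesis unfolding eq by (simp only: Y_def)
  qed (simp add: D_def)
  have "(1 - z h) * ?X (h - 1) e + z h * ((1 - D) * ?X h (e - 1) + D * \<Phi> (h, e))
      \<le> (1 - z h) * ?X (h - 1) e + z h * (\<Phi> (h, e) + 2 * \<gamma> * p * (real e * (real e - 1)))"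
    using E z[of h] by (intro add_left_mono mult_left_mono) auto
  also have "\<dots> \<le> ?X h e"
  proof (cases h)
    case 0
    then show ?thesis using \<gamma> p by (simp add: z_0 \<Phi>_def G_def mult_left_mono)
  next
    case (Suc n)
    define \<Delta> where "\<Delta> = G h - G n"
    have "(1 - z h) * \<Delta> \<le> 1 * (4 * \<gamma> * p * z h)"
    proof (cases "0 \<le> \<Delta>")
      case True
      then show ?thesis using G_step_le[of n] z[of h] by (intro mult_mono) (auto simp: \<Delta>_def Suc)
    next
      case False
      then have "(1 - z h) * \<Delta> \<le> 0" using z[of h] by (intro mult_nonneg_nonpos) auto
      also have "0 \<le> 1 * (4 * \<gamma> * p * z h)" using z[of h] \<gamma> p by simp
      finally show ?thesis .
    qed
    then have *: "real e * ((1 - z h) * \<Delta>) \<le> real e * (4 * \<gamma> * p * z h)" by (intro mult_left_mono) auto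
    have pred: "F (h - 1) = F h - w h" "G (h - 1) = G h - \<Delta>" by (auto simp: F_def Suc \<Delta>_def)
    have "(1 - z h) * ?X (h - 1) e + z h * (\<Phi> (h, e) + 2 * \<gamma> * p * (real e * (real e - 1)))
       = ?X h e + (real e * ((1 - z h) * \<Delta>) - real e * (4 * \<gamma> * p * z h)) + (z h * G h - (1 - z h) * w h)"
      unfolding pred by (simp add: \<Phi>_def algebra_simps)
    moreover have "(1 - z h) * w h = z h * G h" by (simp add: w_def G_def)
    ultimately have "(1 - z h) * ?X (h - 1) e + z h * (\<Phi> (h, e) + 2 * \<gamma> * p * (real e * (real e - 1)))
       = ?X h e + (real e * ((1 - z h) * \<Delta>) - real e * (4 * \<gamma> * p * z h))"
      by simp
    then show ?thesis using * by linarith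
  qed
  finally show "(1 - (1 - p) ^ h) * ?X (h - 1) e + (1 - p) ^ h *
      ((1 - (1 - c) ^ e) * ?X h (e - 1) + (1 - c) ^ e * \<Phi> (h, e)) \<le> ?X h e"
    by (simp only: z_def D_def)
qed (use c p in auto)

definition C\<^sub>1 :: real where "C\<^sub>1 = lH * ((4 + 2 * real d) * \<gamma>) + 2 * lE * \<gamma>"

text \<open>To leading order every E arrival changes \<open>\<Phi>\<close> by - G h: if she joins, e
  grows by one, and if she starts a segment, its first run turns F + G into F. Hence
  \<open>q\<close> cancels. An H arrival adds about w h, and all other effects are O(p (1 +
  e)^2).\<close>

lemma drift_\<Phi>:
  "lH * ((1 - qH) * (\<Phi> (h + 1, e) - \<Phi> (h, e)) + qH * (seg \<Phi> h e - \<Phi> (h, e)))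
      + lE * ((1 - q) * (\<Phi> (h, e + 1) - \<Phi> (h, e)) + q * (seg \<Phi> h e - \<Phi> (h, e)))
    \<le> - lE * (1 - \<gamma> * z h)\<^sup>2 + C\<^sub>1 * p * (1 + real e)\<^sup>2"
proof -
  define E where "E = (1 + real e)\<^sup>2"
  have E: "1 \<le> E" "1 + real e \<le> E" "real e * (real e + 1) \<le> E"
    by (auto simp: E_def power2_eq_square algebra_simps)
  have gp: "0 \<le> \<gamma> * p" using \<gamma> p by simp
  have S: "seg \<Phi> h e - \<Phi> (h, e) \<le> - G h + 2 * (\<gamma> * p * E)"
    using seg_\<Phi>_le[of h e] mult_left_mono[OF E(3) gp] by (simp add: \<Phi>_def mult.assoc)
  have "(1 - real e) * (G (Suc h) - G h) \<le> (1 + real e) * (2 * \<gamma> * p)"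
  proof -
    have "(1 - real e) * (G (Suc h) - G h) \<le> \<bar>1 - real e\<bar> * \<bar>G (Suc h) - G h\<bar>"
      by (metis abs_ge_self abs_mult)
    also have "\<dots> \<le> (1 + real e) * (2 * \<gamma> * p)" using G_step_abs[of h] by (intro mult_mono) auto
    finally show ?thesis .
  qed
  also have "\<dots> \<le> E * (2 * \<gamma> * p)" using E \<gamma> p by (intro mult_right_mono) auto
  finally have "(1 - real e) * (G (Suc h) - G h) \<le> 2 * (\<gamma> * p * E)" by (simp add: mult_ac)
  moreover have "\<Phi> (h + 1, e) - \<Phi> (h, e) = w (Suc h) + (1 - real e) * (G (Suc h) - G h)"
    by (simp add: \<Phi>_def F_def algebra_simps)
  moreover have "2 * \<gamma> * p \<le> 2 * (\<gamma> * p * E)" using mult_left_mono[OF E(1) gp] by simp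
  ultimately have H: "\<Phi> (h + 1, e) - \<Phi> (h, e) \<le> w h + 4 * (\<gamma> * p * E)" using w_step[of h] by linarith
  have gpE: "0 \<le> \<gamma> * p * E" using gp E by simp
  have "(1 - qH) * (\<Phi> (h + 1, e) - \<Phi> (h, e)) + qH * (seg \<Phi> h e - \<Phi> (h, e))
     \<le> (1 - qH) * (w h + 4 * (\<gamma> * p * E)) + qH * (- G h + 2 * (\<gamma> * p * E))"
    using H S qH by (intro add_mono mult_left_mono) auto
  also have "\<dots> = w h + 4 * (\<gamma> * p * E) + qH * (- w h - G h) - 2 * qH * (\<gamma> * p * E)" by (simp add: algebra_simps)
  also have "qH * (- w h - G h) \<le> qH * (2 * \<gamma>)" using G_le[of h] w_le[of h] qH by (intro mult_left_mono) auto
  also have "qH * (2 * \<gamma>) \<le> real d * p * (2 * \<gamma>)" using qH \<gamma> by (intro mult_right_mono) auto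
  also have "real d * p * (2 * \<gamma>) \<le> 2 * real d * (\<gamma> * p * E)"
    using mult_left_mono[OF mult_left_mono[OF E(1) gp], of "2 * real d"] by (simp add: mult_ac)
  also have "w h + 4 * (\<gamma> * p * E) + 2 * real d * (\<gamma> * p * E) - 2 * qH * (\<gamma> * p * E)
      \<le> w h + (4 + 2 * real d) * \<gamma> * p * E"
    using mult_nonneg_nonneg[OF qH(1) gpE] by (simp add: algebra_simps)
  finally have "lH * ((1 - qH) * (\<Phi> (h + 1, e) - \<Phi> (h, e)) + qH * (seg \<Phi> h e - \<Phi> (h, e)))
     \<le> lH * (w h + (4 + 2 * real d) * \<gamma> * p * E)" using lH by (intro mult_left_mono) auto
  moreover have "lE * ((1 - q) * (\<Phi> (h, e + 1) - \<Phi> (h, e)) + q * (seg \<Phi> h e - \<Phi> (h, e)))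
     \<le> lE * (- G h + 2 * (\<gamma> * p * E))"
  proof -
    have "\<Phi> (h, e + 1) - \<Phi> (h, e) = - G h" by (simp add: \<Phi>_def algebra_simps)
    then have "(1 - q) * (\<Phi> (h, e + 1) - \<Phi> (h, e)) + q * (seg \<Phi> h e - \<Phi> (h, e))
        \<le> (1 - q) * (- G h) + q * (- G h + 2 * (\<gamma> * p * E))"
      using S q by (intro add_mono mult_left_mono) auto
    also have "\<dots> = - G h + q * (2 * (\<gamma> * p * E))" by (simp add: algebra_simps)
    also have "q * (2 * (\<gamma> * p * E)) \<le> 2 * (\<gamma> * p * E)" using q gpE by (intro mult_left_le_one_le) auto
    finally show ?thesis using lE by (intro mult_left_mono) auto
  qed
  \<comment> \<open>Since lH = lE (\<gamma> - 1), the factors z and 1 - z combine to (\<gamma> - 1)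
    z - (1 - z) = - (1 - \<gamma> z), completing the square.\<close>
  moreover have "lH * w h - lE * G h = - lE * (1 - \<gamma> * z h)\<^sup>2"
  proof -
    have "lH * w h - lE * G h = lE * (\<gamma> - 1) * w h - lE * G h" by (simp only: \<gamma>(2))
    also have "\<dots> = - lE * (1 - \<gamma> * z h)\<^sup>2"
      by (simp add: w_def G_def power2_eq_square algebra_simps)
    finally show ?thesis .
  qed
  ultimately show ?thesis by (simp add: C\<^sub>1_def E_def[symmetric] algebra_simps)
qed

section \<open>The second moment of the E count\<close>

definition S2 :: real where "S2 = (\<Sum>j. (real j)\<^sup>2 * (1 - c) ^ j)"

text \<open>With s the fourth root of 1 - c, each term is (j s^j)^2 (s^2)^j; the first factor is
  bounded and the second is geometric.\<close>

lemma summable_S2: "summable (\<lambda>j. (real j)\<^sup>2 * (1 - c) ^ j)"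
proof (rule summable_comparison_test')
  define s where "s = sqrt (sqrt (1 - c))"
  have "s ^ 4 = (s\<^sup>2)\<^sup>2" by (simp flip: power_mult)
  then have s: "0 \<le> s" "s < 1" "s ^ 4 = 1 - c"
    using c by (auto simp: s_def)
  then have "s\<^sup>2 < 1" by (simp add: abs_square_less_1)
  then show "summable (\<lambda>j. (1 / (1 - s))\<^sup>2 * (s\<^sup>2) ^ j)"
    using s by (intro summable_mult summable_geometric) simp
  show "norm ((real j)\<^sup>2 * (1 - c) ^ j) \<le> (1 / (1 - s))\<^sup>2 * (s\<^sup>2) ^ j" if "0 \<le> j" for j
  proof -
    have "(real j)\<^sup>2 * (1 - c) ^ j = (real j * s ^ j)\<^sup>2 * (s\<^sup>2) ^ j"
      unfolding s(3)[symmetric] by (simp add: power_mult_distrib power_mult[symmetric] power_add[symmetric] mult.commute)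
    also have "\<dots> \<le> (1 / (1 - s))\<^sup>2 * (s\<^sup>2) ^ j"
      using s by (intro mult_right_mono power_mono of_nat_mult_power_le) auto
    finally show ?thesis using c by (simp add: abs_mult)
  qed
qed

text \<open>A segment faces each level j of the E pool at the end of at most one run and then stops
  with probability (1 - c)^j. The bound is therefore uniform in the starting state.\<close>

lemma seg_square_le: "seg (\<lambda>x. (real (snd x))\<^sup>2) h e \<le> S2"
proof -
  let ?X = "\<lambda>e. \<Sum>j\<le>e. (real j)\<^sup>2 * (1 - c) ^ j"
  have X0: "0 \<le> ?X e" for e using c by (intro sum_nonneg) auto
  have "seg (\<lambda>x. (real (snd x))\<^sup>2) h e \<le> ?X e"
  proof (rule expectation_chain_segment_le[where X = "\<lambda>h e. ?X e"])
    fix h e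
    define D where "D = (1 - c) ^ e"
    have D: "0 \<le> D" "D \<le> 1" using c by (auto simp: D_def power_le_one)
    have "(1 - D) * ?X (e - 1) + D * (real e)\<^sup>2 \<le> ?X e"
    proof (cases e)
      case (Suc n)
      have "(1 - D) * ?X n \<le> ?X n" using D X0[of n] by (intro mult_left_le_one_le) auto
      then show ?thesis by (simp add: Suc D_def mult.commute)
    qed (simp add: D_def)
    then have "z h * ((1 - D) * ?X (e - 1) + D * (real e)\<^sup>2) \<le> z h * ?X e"
      using z[of h] by (intro mult_left_mono) auto
    then have "(1 - z h) * ?X e + z h * ((1 - D) * ?X (e - 1) + D * (real e)\<^sup>2) \<le> ?X e"
      by (simp add: algebra_simps)
    then show "(1 - (1 - p) ^ h) * ?X e + (1 - p) ^ h * ((1 - (1 - c) ^ e) * ?X (e - 1)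
        + (1 - c) ^ e * (real (snd (h, e)))\<^sup>2) \<le> ?X e"
      by (simp only: z_def D_def snd_conv)
  qed (use c p in auto)
  also have "\<dots> \<le> S2" unfolding S2_def
    using sum_le_suminf[OF summable_S2, of "{..e}"] c by simp
  finally show ?thesis .
qed

lemma S2_nonneg: "0 \<le> S2"
  unfolding S2_def using c by (intro suminf_nonneg summable_S2) auto

text \<open>With probability q an E arrival starts a segment that replaces e^2 by at most S2 on
  average. Half of the gain lE q e^2 is spent on the linear term 2 e.\<close>

lemma drift_square:
  defines "W \<equiv> \<lambda>x::state. (real (snd x))\<^sup>2"
  shows "lH * ((1 - qH) * (W (h + 1, e) - W (h, e)) + qH * (seg W h e - W (h, e)))
      + lE * ((1 - q) * (W (h, e + 1) - W (h, e)) + q * (seg W h e - W (h, e)))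
    \<le> (lH + lE) * S2 + lE * (1 + 2 / q) - lE * q / 2 * (real e)\<^sup>2"
proof -
  have S: "seg W h e \<le> S2" unfolding W_def by (rule seg_square_le)
  have "qH * (seg W h e - W (h, e)) \<le> 1 * S2"
  proof -
    have "qH * (seg W h e - W (h, e)) \<le> qH * S2" using qH
    proof (intro mult_left_mono)
      have "0 \<le> W (h, e)" by (simp add: W_def)
      with S show "seg W h e - W (h, e) \<le> S2" by linarith
    qed
    also have "\<dots> \<le> 1 * S2" using qH S2_nonneg by (intro mult_right_mono) auto
    finally show ?thesis .
  qed
  then have 1: "lH * ((1 - qH) * (W (h + 1, e) - W (h, e)) + qH * (seg W h e - W (h, e))) \<le> lH * S2"
    using lH by (intro mult_left_mono) (auto simp: W_def)
  have "(1 - q) * (2 * real e + 1) \<le> 2 * real e + 1" using q by (intro mult_left_le_one_le) auto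
  moreover have "q * (seg W h e - W (h, e)) \<le> S2 - q * (real e)\<^sup>2"
  proof -
    have "q * seg W h e \<le> q * S2" using S q by (intro mult_left_mono) auto
    also have "\<dots> \<le> 1 * S2" using q S2_nonneg by (intro mult_right_mono) auto
    finally show ?thesis by (simp add: W_def right_diff_distrib)
  qed
  moreover have "2 * real e \<le> q / 2 * (real e)\<^sup>2 + 2 / q"
  proof -
    have "0 \<le> q / 2 * (real e - 2 / q)\<^sup>2" using q by simp
    also have "\<dots> = q / 2 * (real e)\<^sup>2 + 2 / q - 2 * real e"
      using q by (simp add: power2_eq_square field_simps)
    finally show ?thesis by simp
  qed
  moreover have "W (h, e + 1) - W (h, e) = 2 * real e + 1" by (simp add: W_def power2_eq_square algebra_simps)
  ultimately have "(1 - q) * (W (h, e + 1) - W (h, e)) + q * (seg W h e - W (h, e))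
      \<le> S2 + (1 + 2 / q) - q / 2 * (real e)\<^sup>2" by (simp add: field_simps)
  then have "lE * ((1 - q) * (W (h, e + 1) - W (h, e)) + q * (seg W h e - W (h, e)))
      \<le> lE * (S2 + (1 + 2 / q) - q / 2 * (real e)\<^sup>2)" using lE by (intro mult_left_mono) auto
  with 1 show ?thesis by (simp add: algebra_simps)
qed

section \<open>The tail potential for large h\<close>

text \<open>\<open>T\<close> has the same form \<open>F + G\<close>, with weight \<open>t z\<close>; it controls the mean beyond the level \<open>m\<close>, where
  \<open>\<Phi>\<close> has bounded drift. The value of \<open>\<epsilon>\<close> makes
  \<open>lE q (1 - z) - lH z \<ge> lE q / 2\<close> for \<open>z \<le> \<epsilon>\<close>.\<close>

definition \<epsilon> :: real where "\<epsilon> = lE * q / (2 * (lE * q + lH))"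
definition m :: real where "m = - ln \<epsilon> / a"
definition t :: "nat \<Rightarrow> real" where "t h = max 0 (real h - m)"
definition F1 :: "nat \<Rightarrow> real" where "F1 h = (\<Sum>k<h. t (Suc k) * z (Suc k))"
definition T :: "state \<Rightarrow> real" where "T = (\<lambda>(h, e). F1 h + t h * (1 - z h))"

lemma lEq: "0 < lE * q" using lE q by simp

text \<open>The bound on \<gamma> \<epsilon>, which rests on q \<le> 1, places \<open>m\<close>
  above the fluid balance, with 1 - \<gamma> z \<ge> 1/2 beyond it.\<close>

lemma \<epsilon>: "0 < \<epsilon>" "\<gamma> * \<epsilon> \<le> 1 / 2" "\<epsilon> \<le> 1 / 2"
proof -
  show "0 < \<epsilon>" using lEq lH by (simp add: \<epsilon>_def)
  have "\<gamma> * \<epsilon> = ((lE + lH) * q) / (2 * (lE * q + lH))"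
  proof -
    have "\<gamma> = (lE + lH) / lE" using lE by (simp add: \<gamma>_def field_simps)
    then show ?thesis using lE by (simp add: \<epsilon>_def)
  qed
  also have "\<dots> \<le> (lE * q + lH) / (2 * (lE * q + lH))"
    using lEq lH q by (intro divide_right_mono) (auto simp: algebra_simps mult_left_le)
  also have "\<dots> = 1 / 2" using lEq lH by (simp add: field_simps)
  finally show "\<gamma> * \<epsilon> \<le> 1 / 2" .
  then show "\<epsilon> \<le> 1 / 2" using \<gamma>(1) \<open>0 < \<epsilon>\<close> mult_right_mono[of 1 \<gamma> \<epsilon>] by linarith
qed

lemma m_pos: "0 < m"
  using \<epsilon> a by (simp add: m_def divide_neg_pos)

lemma t: "0 \<le> t h" "t (Suc h) \<le> t h + 1"
  by (auto simp: t_def)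

lemma t_0: "t 0 = 0"
  using m_pos by (simp add: t_def)

lemma z_less_\<epsilon>_iff: "z h < \<epsilon> \<longleftrightarrow> m < real h"
proof -
  have "z h < \<epsilon> \<longleftrightarrow> - (a * real h) < ln \<epsilon>"
    unfolding z_eq_exp using \<epsilon> by (metis exp_less_cancel_iff exp_ln)
  also have "\<dots> \<longleftrightarrow> - ln \<epsilon> < real h * a" by (auto simp: mult.commute)
  also have "\<dots> \<longleftrightarrow> m < real h" unfolding m_def by (rule pos_divide_less_eq[OF a(3), symmetric])
  finally show ?thesis .
qed

text \<open>As t (1 - z) \<ge> 0, continuing with an E agent, worth \<open>F1\<close>, is dominated
  by stopping; an upper bound thus follows from the first run alone, without a corrector.\<close>

lemma seg_T_le: "seg T h e \<le> F1 h"
proof (rule expectation_chain_segment_le[where X = "\<lambda>h e. F1 h"])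
  fix h e
  define D where "D = (1 - c) ^ e"
  have D: "0 \<le> D" "D \<le> 1" using c by (auto simp: D_def power_le_one)
  have "0 \<le> t h * (1 - z h)" using t z[of h] by simp
  then have "D * (t h * (1 - z h)) \<le> t h * (1 - z h)" using D by (intro mult_left_le_one_le) auto
  then have "(1 - D) * F1 h + D * T (h, e) \<le> F1 h + t h * (1 - z h)" by (simp add: T_def algebra_simps)
  then have "(1 - z h) * F1 (h - 1) + z h * ((1 - D) * F1 h + D * T (h, e))
      \<le> (1 - z h) * F1 (h - 1) + z h * (F1 h + t h * (1 - z h))"
    using z[of h] by (intro add_left_mono mult_left_mono) auto
  also have "\<dots> = F1 h" by (cases h) (auto simp: z_0 t_0 F1_def algebra_simps)
  finally show "(1 - (1 - p) ^ h) * F1 (h - 1) + (1 - p) ^ h * ((1 - (1 - c) ^ e) * F1 h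
      + (1 - c) ^ e * T (h, e)) \<le> F1 h"
    by (simp only: z_def D_def)
qed (use c p in auto)

text \<open>Joining adds at most 1 + t z, and a segment started by an E arrival removes t (1 - z) on
  average. Where t is positive, z < \<epsilon> leaves half of lE q t.\<close>

lemma drift_T:
  "lH * ((1 - qH) * (T (h + 1, e) - T (h, e)) + qH * (seg T h e - T (h, e)))
      + lE * ((1 - q) * (T (h, e + 1) - T (h, e)) + q * (seg T h e - T (h, e)))
    \<le> lH - lE * q / 2 * t h"
proof -
  have tz: "0 \<le> t h * (1 - z h)" "0 \<le> t h * z h" using t[of h] z[of h] by auto
  have S: "seg T h e - T (h, e) \<le> - (t h * (1 - z h))" using seg_T_le[of h e] by (simp add: T_def)
  have "T (h + 1, e) - T (h, e) = t (Suc h) - t h * (1 - z h)" by (simp add: T_def F1_def algebra_simps)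
  also have "\<dots> \<le> 1 + t h * z h" using t[of h] by (simp add: algebra_simps)
  finally have "(1 - qH) * (T (h + 1, e) - T (h, e)) + qH * (seg T h e - T (h, e)) \<le> (1 - qH) * (1 + t h * z h) + qH * 0"
    using S tz qH by (intro add_mono mult_left_mono) auto
  also have "\<dots> \<le> 1 + t h * z h" using qH tz mult_left_le_one_le[of "1 + t h * z h" "1 - qH"] by simp
  finally have 1: "lH * ((1 - qH) * (T (h + 1, e) - T (h, e)) + qH * (seg T h e - T (h, e))) \<le> lH * (1 + t h * z h)"
    using lH by (intro mult_left_mono) auto
  have "(1 - q) * (T (h, e + 1) - T (h, e)) + q * (seg T h e - T (h, e)) \<le> q * (- (t h * (1 - z h)))"
  proof -
    have "T (h, e + 1) - T (h, e) = 0" by (simp add: T_def)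
    moreover have "q * (seg T h e - T (h, e)) \<le> q * (- (t h * (1 - z h)))"
      using S q by (intro mult_left_mono) auto
    ultimately show ?thesis by (simp only: mult_zero_right add_0)
  qed
  then have 2: "lE * ((1 - q) * (T (h, e + 1) - T (h, e)) + q * (seg T h e - T (h, e))) \<le> lE * (q * (- (t h * (1 - z h))))"
    using lE by (intro mult_left_mono) auto
  have 3: "t h * ((lE * q + lH) * z h) \<le> t h * (lE * q / 2)"
  proof (cases "m < real h")
    case True
    then have "(lE * q + lH) * z h \<le> (lE * q + lH) * \<epsilon>"
      using z_less_\<epsilon>_iff[of h] lEq lH by (intro mult_left_mono) auto
    also have "\<dots> = lE * q / 2"
    proof -
      have "s * (r / (2 * s)) = r / 2" if "0 < s" for r s :: real using that by simp
      from this[of "lE * q + lH" "lE * q"] show ?thesis using lEq lH by (simp add: \<epsilon>_def)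
    qed
    finally show ?thesis using t by (intro mult_left_mono) auto
  qed (simp add: t_def)
  have "lH * (1 + t h * z h) + lE * (q * (- (t h * (1 - z h))))
      = lH + t h * ((lE * q + lH) * z h) - 2 * (t h * (lE * q / 2))"
    by (simp add: algebra_simps)
  moreover have "lE * q / 2 * t h = t h * (lE * q / 2)" by simp
  ultimately show ?thesis using 1 2 3 by linarith
qed

section \<open>The combined Lyapunov function for ChainMatch(d)\<close>

text \<open>K lE q / 2 = 2 \<open>C\<^sub>1\<close> + 1 cancels the 2 \<open>C\<^sub>1\<close> e^2
  coming from \<open>\<Phi>\<close> / p and leaves the e^2 of \<open>g\<close>. The constant
  \<open>b\<close> is free of p because \<open>q\<close>, \<open>C\<^sub>1\<close> and
  \<open>S2\<close> are.\<close>

definition K :: real where "K = 2 * (2 * C\<^sub>1 + 1) / (lE * q)"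
definition b :: real where "b = 2 * C\<^sub>1 + K * ((lH + lE) * S2 + lE * (1 + 2 / q)) + lH"
definition g :: "state \<Rightarrow> real" where
  "g = (\<lambda>(h, e). lE / p * (1 - \<gamma> * z h)\<^sup>2 + lE * q / 2 * t h + (real e)\<^sup>2)"
definition V :: "state \<Rightarrow> real" where "V x = \<Phi> x / p + K * (real (snd x))\<^sup>2 + T x"

lemma C\<^sub>1_pos: "0 < C\<^sub>1" using lH lE \<gamma> by (simp add: C\<^sub>1_def add_nonneg_pos)

lemma K_pos: "0 < K" using C\<^sub>1_pos lEq by (simp add: K_def)

lemma b_nonneg: "0 \<le> b"
  unfolding b_def using C\<^sub>1_pos K_pos S2_nonneg lH lE q
  by (intro add_nonneg_nonneg mult_nonneg_nonneg) auto

lemma g_nonneg: "0 \<le> g x"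
  using lE lEq p t by (cases x) (simp add: g_def add_nonneg_nonneg)

lemma chain_drift: "(\<Sum>y\<in>box x. chain_rate d lH lE c p x y * (V y - V x)) \<le> b - g x"
proof -
  obtain h e where x: "x = (h, e)" by (cases x)
  let ?W = "\<lambda>x::state. (real (snd x))\<^sup>2"
  let ?L = "\<lambda>f. \<Sum>y\<in>box x. chain_rate d lH lE c p x y * (f y - f x)"
  have LV: "?L V = ?L \<Phi> / p + K * ?L ?W + ?L T"
    unfolding sum_divide_distrib sum_distrib_left sum.distrib[symmetric]
    by (intro sum.cong) (auto simp: V_def algebra_simps diff_divide_distrib add_divide_distrib)
  have "?L \<Phi> / p \<le> (- lE * (1 - \<gamma> * z h)\<^sup>2 + C\<^sub>1 * p * (1 + real e)\<^sup>2) / p"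
    unfolding x chain_generator using p by (intro divide_right_mono drift_\<Phi>) auto
  also have "\<dots> = - (lE / p * (1 - \<gamma> * z h)\<^sup>2) + C\<^sub>1 * (1 + real e)\<^sup>2"
    using p by (simp add: add_divide_distrib diff_divide_distrib)
  finally have 1: "?L \<Phi> / p \<le> - (lE / p * (1 - \<gamma> * z h)\<^sup>2) + C\<^sub>1 * (1 + real e)\<^sup>2" .
  have "0 \<le> (1 - real e)\<^sup>2" by simp
  then have "(1 + real e)\<^sup>2 \<le> 2 + 2 * (real e)\<^sup>2" by (simp add: power2_eq_square algebra_simps)
  then have 2: "C\<^sub>1 * (1 + real e)\<^sup>2 \<le> C\<^sub>1 * (2 + 2 * (real e)\<^sup>2)"
    using C\<^sub>1_pos by (intro mult_left_mono) auto
  define r where "r = lE * q / 2 * (real e)\<^sup>2"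
  have "?L ?W \<le> (lH + lE) * S2 + lE * (1 + 2 / q) - r"
    unfolding x r_def by (rule ord_eq_le_trans[OF chain_generator[of h e ?W] drift_square])
  then have 3: "K * ?L ?W \<le> K * ((lH + lE) * S2 + lE * (1 + 2 / q) - r)"
    using K_pos by (intro mult_left_mono) auto
  have "K * (lE * q / 2) = 2 * C\<^sub>1 + 1" using lE q by (simp add: K_def)
  then have "K * r = (2 * C\<^sub>1 + 1) * (real e)\<^sup>2"
    unfolding r_def by (simp only: mult.assoc[symmetric])
  with 3 have 3: "K * ?L ?W \<le> K * ((lH + lE) * S2 + lE * (1 + 2 / q)) - (2 * C\<^sub>1 + 1) * (real e)\<^sup>2"
    by (simp only: right_diff_distrib)
  have 4: "?L T \<le> lH - lE * q / 2 * t h"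
    unfolding x chain_generator by (rule drift_T)
  have 5: "C\<^sub>1 * (2 + 2 * (real e)\<^sup>2) - (2 * C\<^sub>1 + 1) * (real e)\<^sup>2 = 2 * C\<^sub>1 - (real e)\<^sup>2"
    by (simp add: algebra_simps)
  have "g x = lE / p * (1 - \<gamma> * z h)\<^sup>2 + lE * q / 2 * t h + (real e)\<^sup>2" by (simp add: g_def x)
  then show ?thesis unfolding b_def using LV 1 2 3 4 5 by linarith
qed

lemma F_ge: "- (\<gamma> / p) \<le> F h"
proof -
  have w: "- (\<gamma> * z (Suc k)) \<le> w (Suc k)" for k
  proof -
    have "z (Suc k) * (- \<gamma>) \<le> z (Suc k) * (1 - \<gamma> * z (Suc k))"
      using abs_le_\<gamma>[of "Suc k"] z(1)[of "Suc k"] by (intro mult_left_mono) auto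
    then show ?thesis by (simp add: w_def mult.commute)
  qed
  have "(\<Sum>k<h. z (Suc k)) \<le> (\<Sum>k<h. (1 - p) ^ k)"
    using p by (intro sum_mono) (auto simp: z_def mult_left_le_one_le)
  also have "\<dots> = (1 - (1 - p) ^ h) / p" using p by (subst sum_gp_strict) auto
  also have "\<dots> \<le> 1 / p" using p by (intro divide_right_mono) auto
  finally have "\<gamma> * (\<Sum>k<h. z (Suc k)) \<le> \<gamma> * (1 / p)" using \<gamma> by (intro mult_left_mono) auto
  then have "- (\<gamma> / p) \<le> (\<Sum>k<h. - (\<gamma> * z (Suc k)))" by (simp add: sum_negf sum_distrib_left)
  also have "\<dots> \<le> F h" unfolding F_def by (intro sum_mono w)
  finally show ?thesis .
qed

text \<open>Only boundedness below for each fixed p matters. The unbounded part - e G / p is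
  absorbed by K e^2 through the square centred at r.\<close>

lemma V_ge: "- ((\<gamma> / p + \<gamma>) / p + \<gamma>\<^sup>2 / (4 * K * p\<^sup>2)) \<le> V x"
proof -
  obtain h e where x: "x = (h, e)" by (cases x)
  have "real e * G h \<le> real e * \<gamma>" using G_le[of h] by (intro mult_left_mono) auto
  then have "- (\<gamma> / p + \<gamma>) - real e * \<gamma> \<le> \<Phi> x" using F_ge[of h] G_le[of h] by (simp add: \<Phi>_def x)
  then have "(- (\<gamma> / p + \<gamma>) - real e * \<gamma>) / p \<le> \<Phi> x / p" using p by (intro divide_right_mono) auto
  moreover have "- (\<gamma>\<^sup>2 / (4 * K * p\<^sup>2)) \<le> K * (real e)\<^sup>2 - real e * \<gamma> / p"
  proof -
    define r where "r = \<gamma> / (2 * K * p)"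
    have r: "K * (2 * r) = \<gamma> / p" "K * r\<^sup>2 = \<gamma>\<^sup>2 / (4 * K * p\<^sup>2)"
      using K_pos p by (simp_all add: r_def power2_eq_square)
    have "0 \<le> K * (real e - r)\<^sup>2" using K_pos by simp
    also have "\<dots> = K * (real e)\<^sup>2 - real e * (K * (2 * r)) + K * r\<^sup>2"
      by (simp add: power2_eq_square algebra_simps)
    finally show ?thesis unfolding r by simp
  qed
  moreover have "0 \<le> T x"
    using t(1) z(1,2) by (auto simp: x T_def F1_def less_imp_le intro!: add_nonneg_nonneg sum_nonneg mult_nonneg_nonneg)
  moreover have "(- (\<gamma> / p + \<gamma>) - real e * \<gamma>) / p = - ((\<gamma> / p + \<gamma>) / p) - real e * \<gamma> / p"
    by (simp only: diff_divide_distrib minus_divide_left)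
  ultimately show ?thesis unfolding V_def x snd_conv by linarith
qed

lemma g_level: "finite {x. g x \<le> M}"
proof (rule finite_subset)
  show "{x. g x \<le> M} \<subseteq> {..nat \<lceil>m + 2 * M / (lE * q)\<rceil>} \<times> {..nat \<lceil>M\<rceil>}"
  proof
    fix x assume "x \<in> {x. g x \<le> M}"
    then have gx: "g x \<le> M" by simp
    obtain h e where x: "x = (h, e)" by (cases x)
    have nn: "0 \<le> lE / p * (1 - \<gamma> * z h)\<^sup>2" "0 \<le> lE * q / 2 * t h" "0 \<le> (real e)\<^sup>2"
      using lE lEq p t[of h] by auto
    moreover have "lE / p * (1 - \<gamma> * z h)\<^sup>2 + lE * q / 2 * t h + (real e)\<^sup>2 \<le> M"
      using gx by (simp only: x g_def prod.case)
    ultimately have "lE * q / 2 * t h \<le> M" "(real e)\<^sup>2 \<le> M" by linarith+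
    moreover have "real e \<le> (real e)\<^sup>2" by (cases e) (auto simp: power2_eq_square)
    ultimately have e: "real e \<le> M" by linarith
    have "t h \<le> 2 * M / (lE * q)"
      using \<open>lE * q / 2 * t h \<le> M\<close> lEq by (simp add: field_simps)
    then have "real h \<le> m + 2 * M / (lE * q)" by (simp add: t_def)
    with e have "e \<le> nat \<lceil>M\<rceil>" "h \<le> nat \<lceil>m + 2 * M / (lE * q)\<rceil>" by linarith+
    then show "x \<in> {..nat \<lceil>m + 2 * M / (lE * q)\<rceil>} \<times> {..nat \<lceil>M\<rceil>}"
      by (simp add: x)
  qed
qed auto

lemma chain_mean_le: "(\<integral>\<^sup>+x. ennreal (g x) \<partial>steady_state (chain_rate d lH lE c p)) \<le> ennreal b"
  using steady_state_drift_bound[where V = V and f = g, OF V_ge g_nonneg b_nonneg chain_drift g_level chain_reach] .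

definition hs :: real where "hs = ln \<gamma> / a"

lemma hs_nonneg: "0 \<le> hs" using \<gamma> a by (simp add: hs_def)

text \<open>\<gamma> z = exp (- a (h - hs)). Above \<gamma> \<epsilon> the logarithm is Lipschitz.
  Below, t carries the excess of h over \<open>m\<close>, and the remaining constant - ln (\<gamma>
  \<epsilon>) is paid by \<bar>1 - \<gamma> z\<bar> \<ge> 1/2.\<close>

lemma log_deviation_le: "a * \<bar>real h - hs\<bar> \<le> 2 / (\<gamma> * \<epsilon>) * \<bar>1 - \<gamma> * z h\<bar> + a * t h"
proof -
  define \<eta> where "\<eta> = \<gamma> * \<epsilon>"
  define x where "x = \<gamma> * z h"
  define u where "u = a * (real h - hs)"
  have \<eta>: "0 < \<eta>" "\<eta> \<le> 1 / 2" using \<epsilon> \<gamma> by (auto simp: \<eta>_def)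
  have x0: "0 < x" using z[of h] \<gamma> by (simp add: x_def)
  have u: "u = a * real h - ln \<gamma>" using a by (simp add: u_def hs_def right_diff_distrib)
  have ux: "u = - ln x" using z[of h] \<gamma> by (simp add: u x_def ln_mult) (simp add: z_eq_exp)
  have at: "0 \<le> a * t h" using a t by simp
  have "\<bar>u\<bar> \<le> 2 / \<eta> * \<bar>1 - x\<bar> + a * t h"
  proof (cases "\<eta> \<le> x")
    case True
    have "\<bar>ln x\<bar> \<le> 1 / \<eta> * \<bar>1 - x\<bar>"
    proof (cases "1 \<le> x")
      case True
      then have "\<bar>ln x\<bar> \<le> 1 * \<bar>1 - x\<bar>" using ln_le_minus_one[OF x0] by simp
      also have "\<dots> \<le> 1 / \<eta> * \<bar>1 - x\<bar>" using \<eta> by (intro mult_right_mono) auto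
      finally show ?thesis .
    next
      case False
      then have "\<bar>ln x\<bar> = ln (1 / x)" using x0 by (simp add: ln_div)
      also have "\<dots> \<le> 1 / x - 1" using x0 by (intro ln_le_minus_one) auto
      also have "\<dots> = 1 / x * \<bar>1 - x\<bar>" using x0 False by (simp add: field_simps)
      also have "\<dots> \<le> 1 / \<eta> * \<bar>1 - x\<bar>" using True \<eta> x0 by (intro mult_right_mono divide_left_mono) auto
      finally show ?thesis .
    qed
    also have "\<dots> \<le> 2 / \<eta> * \<bar>1 - x\<bar>" using \<eta> by (intro mult_right_mono divide_right_mono) auto
    finally show ?thesis using at by (simp add: ux)
  next
    case False
    then have "z h < \<epsilon>" using \<gamma> by (simp add: \<eta>_def x_def)
    then have "t h = real h - m" using z_less_\<epsilon>_iff[of h] by (simp add: t_def)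
    then have "a * t h = a * real h + ln \<epsilon>" using a by (simp add: m_def distrib_left)
    then have "u - a * t h = - ln \<eta>" using \<epsilon> \<gamma> by (simp add: u \<eta>_def ln_mult)
    also have "\<dots> = ln (1 / \<eta>)" using \<eta> by (simp add: ln_div)
    also have "\<dots> \<le> 1 / \<eta> - 1" using \<eta> by (intro ln_le_minus_one) auto
    also have "\<dots> \<le> 2 / \<eta> * (1 / 2)" by simp
    also have "\<dots> \<le> 2 / \<eta> * \<bar>1 - x\<bar>" using False \<eta> by (intro mult_left_mono) auto
    finally have "u \<le> 2 / \<eta> * \<bar>1 - x\<bar> + a * t h" by simp
    moreover have "0 \<le> u" using False \<eta> x0 by (simp add: ux)
    ultimately show ?thesis by simp
  qed
  then show ?thesis using a by (simp add: u_def \<eta>_def x_def abs_mult)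
qed

lemma chain_close:
  assumes \<delta>: "0 < \<delta>"
  shows "\<bar>p * real (fst x) - p * hs\<bar> \<le> \<delta> + (4 / (\<delta> * (\<gamma> * \<epsilon>)\<^sup>2 * lE) + 4 / (lE * q)) * p * g x"
proof -
  obtain h e where x: "x = (h, e)" by (cases x)
  define \<eta> where "\<eta> = \<gamma> * \<epsilon>"
  define s where "s = 1 - \<gamma> * z h"
  have \<eta>: "0 < \<eta>" using \<epsilon> \<gamma> by (auto simp: \<eta>_def)
  have "\<bar>p * real h - p * hs\<bar> = p * \<bar>real h - hs\<bar>" using p by (simp add: abs_mult right_diff_distrib[symmetric])
  also have "\<dots> \<le> a * \<bar>real h - hs\<bar>" using a by (intro mult_right_mono) auto
  also have "\<dots> \<le> 2 / \<eta> * \<bar>s\<bar> + a * t h" unfolding \<eta>_def s_def by (rule log_deviation_le)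
  \<comment> \<open>Young's inequality trades the linear deviation for \<delta> plus the square that
    p g controls.\<close>
  also have "2 / \<eta> * \<bar>s\<bar> \<le> \<delta> + 4 / (\<delta> * \<eta>\<^sup>2) * s\<^sup>2"
  proof -
    have "0 \<le> (\<delta> - 2 / \<eta> * \<bar>s\<bar>)\<^sup>2" by simp
    then have "2 * \<delta> * (2 / \<eta> * \<bar>s\<bar>) \<le> \<delta>\<^sup>2 + (2 / \<eta> * \<bar>s\<bar>)\<^sup>2" by (simp add: power2_eq_square algebra_simps)
    also have "(2 / \<eta> * \<bar>s\<bar>)\<^sup>2 = \<delta> * (4 / (\<delta> * \<eta>\<^sup>2) * s\<^sup>2)" using \<delta> \<eta> by (simp add: power2_eq_square)
    finally have "\<delta> * (2 * (2 / \<eta> * \<bar>s\<bar>)) \<le> \<delta> * (\<delta> + 4 / (\<delta> * \<eta>\<^sup>2) * s\<^sup>2)" by (simp add: power2_eq_square algebra_simps)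
    then have "2 * (2 / \<eta> * \<bar>s\<bar>) \<le> \<delta> + 4 / (\<delta> * \<eta>\<^sup>2) * s\<^sup>2"
      using \<delta> by (rule mult_left_le_imp_le)
    moreover have "0 \<le> 2 / \<eta> * \<bar>s\<bar>" using \<eta> by simp
    ultimately show ?thesis by linarith
  qed
  also have "4 / (\<delta> * \<eta>\<^sup>2) * s\<^sup>2 \<le> 4 / (\<delta> * \<eta>\<^sup>2 * lE) * p * g x"
  proof -
    have "lE / p * s\<^sup>2 \<le> g x" using lEq t[of h] by (simp add: g_def x s_def)
    then have "4 / (\<delta> * \<eta>\<^sup>2 * lE) * p * (lE / p * s\<^sup>2) \<le> 4 / (\<delta> * \<eta>\<^sup>2 * lE) * p * g x"
      using \<delta> \<eta> lE p by (intro mult_left_mono) auto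
    then show ?thesis using lE p by simp
  qed
  also have "a * t h \<le> 4 / (lE * q) * p * g x"
  proof -
    have "lE * q / 2 * t h \<le> g x" using lE p by (simp add: g_def x)
    then have "4 / (lE * q) * p * (lE * q / 2 * t h) \<le> 4 / (lE * q) * p * g x"
      using lEq p by (intro mult_left_mono) auto
    moreover have "4 / (lE * q) * p * (lE * q / 2 * t h) = 2 * p * t h" using lE q by simp
    moreover have "a * t h \<le> 2 * p * t h" using a t by (intro mult_right_mono) auto
    ultimately show ?thesis by linarith
  qed
  finally show ?thesis by (simp add: x \<eta>_def distrib_right)
qed

end

lemma chain_tendsto:
  fixes lH lE c :: real
  assumes lH: "0 < lH" and lE: "0 < lE" and c: "0 < c" "c \<le> 1" and d: "1 \<le> d"
  shows "((\<lambda>p. ennreal p * waiting_time_H lH (chain_rate d lH lE c p))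
    \<longlongrightarrow> ennreal (ln (1 + lH / lE) / lH)) (at_right 0)"
proof (rule waiting_time_tendsto)
  have loc: "\<forall>\<^sub>F p in at_right (0::real). chain_match lH lE c p d"
    using assms by (auto simp: chain_match_def eventually_at_right[of 0 "1::real"] intro!: exI[of _ "1 / 2"])
  have loc2: "chain_match lH lE c (1 / 2) d" using assms by (simp add: chain_match_def)
  let ?g = "\<lambda>p. chain_match.g lH lE c p d" and ?C = "chain_match.b lH lE c d" and ?h = "\<lambda>p. chain_match.hs lH lE p"
  show "0 < lH" by fact
  show "\<forall>\<^sub>F p in at_right 0. (\<forall>x. 0 \<le> ?g p x) \<and>
      (\<integral>\<^sup>+x. ennreal (?g p x) \<partial>steady_state (chain_rate d lH lE c p)) \<le> ennreal ?C"
    using loc by eventually_elim (simp add: chain_match.g_nonneg chain_match.chain_mean_le)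
  show "\<forall>\<^sub>F p in at_right 0. 0 \<le> ?h p"
    using loc by eventually_elim (rule chain_match.hs_nonneg)
  show "0 \<le> ?C" using loc2 by (rule chain_match.b_nonneg)
  show "\<exists>K\<ge>0. \<forall>\<^sub>F p in at_right 0. \<forall>x. \<bar>p * real (fst x) - p * ?h p\<bar> \<le> \<delta> + K * p * ?g p x"
    if "0 < \<delta>" for \<delta>
  proof (intro exI conjI)
    let ?K = "4 / (\<delta> * (chain_match.\<gamma> lH lE * chain_match.\<epsilon> lH lE c d)\<^sup>2 * lE) + 4 / (lE * chain_match.q c d)"
    show "0 \<le> ?K" using that lE chain_match.q[OF loc2] by simp
    show "\<forall>\<^sub>F p in at_right 0. \<forall>x. \<bar>p * real (fst x) - p * ?h p\<bar> \<le> \<delta> + ?K * p * ?g p x"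
      using loc by eventually_elim (intro allI chain_match.chain_close that)
  qed
  show "((\<lambda>p. p * ?h p) \<longlongrightarrow> ln (1 + lH / lE)) (at_right 0)"
  proof -
    have "((\<lambda>p. p * (L / - ln (1 - p))) \<longlongrightarrow> L) (at_right 0)" for L :: real
      by real_asymp
    moreover have "\<forall>\<^sub>F p in at_right 0. p * (ln (1 + lH / lE) / - ln (1 - p)) = p * ?h p"
      using loc by eventually_elim (simp add: chain_match.hs_def chain_match.\<gamma>_def chain_match.a_def)
    ultimately show ?thesis by (rule Lim_transform_eventually)
  qed
qed

theorem corollary3:
  fixes lH lE pE :: real and d :: nat
  assumes "0 < lH" and "0 < lE" and "0 < pE" and "pE \<le> 1" and "1 \<le> d"
    and "lH < lE"
  shows "\<exists>LC LB :: ennreal.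
      ((\<lambda>pH. ennreal pH * waiting_time_H lH (chain_rate d lH lE pE pH)) \<longlongrightarrow> LC) (at_right 0) \<and>
      ((\<lambda>pH. ennreal pH * waiting_time_H lH (bilateral_rate lH lE pE pH)) \<longlongrightarrow> LB) (at_right 0) \<and>
      LC < LB \<and> LB < \<top>"
proof (intro exI conjI)
  define r where "r = lH / lE"
  have r: "0 < r" "r < 1" using assms by (auto simp: r_def)
  have "ln (1 + r) + ln (1 - r) = ln ((1 + r) * (1 - r))" using r by (simp add: ln_mult)
  also have "\<dots> < 0"
    using r mult_strict_mono[of r 1 r 1] by (subst ln_less_zero_iff) (auto simp: algebra_simps)
  finally have "ln (1 + r) < - ln (1 - r)" by simp
  also have "\<dots> \<le> - ln (1 - r) / pE"
    using r assms divide_left_mono[of pE 1 "- ln (1 - r)"] by simp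
  finally have less: "ln (1 + r) / lH < - ln (1 - r) / pE / lH"
    using assms by (intro divide_strict_right_mono) auto
  have "0 < ln (1 + r) / lH" using r assms by simp
  \<comment> \<open>This goal fixes the witnesses LC and LB. Positivity is needed because
    \<open>ennreal\<close> clips negative numbers.\<close>
  with less show "ennreal (ln (1 + lH / lE) / lH) < ennreal (- ln (1 - lH / lE) / pE / lH)"
    unfolding r_def[symmetric] by (intro ennreal_lessI) auto
  show "ennreal (- ln (1 - lH / lE) / pE / lH) < \<top>" by simp
qed (rule chain_tendsto bilateral_tendsto; use assms in simp)+

end
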